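(* Consider the following collections of elements of $MU_{\mathbf{v}}(2)$: \begin{align*}\mathscr{B}_0&= \{ f^re^sk^t~|~r,s\geq 0,~ t\in\mathbb{Z}\}, \\ \mathscr{B}_1&=\{\ell f^re^sk^t~|~r,s\geq0,~t\in\mathbb{Z}\}, \\ \mathscr{B}_2&=\{f^re^s\ell k^t~|~r,s\geq 0,~(r,s)\neq (0,0),~t\in \mathbb{Z}\}, \\ \mathscr{B}_3&=\{\ell f^re^s\ell k^t~|~r,s\geq 1,~t\in\mathbb{Z}\},\\ \mathscr{B}_4&=\{f^r\ell e^s k^t~|~r,s\geq 1,~t\in\mathbb{Z}\},\\ \mathscr{B}_5&=\{e^s\ell f^rk^t~|~r,s\geq 1,~t\in\mathbb{Z}\}. \end{align*} Then the set $\mathscr{B}=\bigsqcup_{i=0}^5 \mathscr{B}_i$ is linearly independent over $\mathbb{C}(\mathbf{v})$, hence it is a basis of $MU_{\mathbf{v}}(2)$.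
   Context: $\mathbf{v}$ is an indeterminate and $[2]=\mathbf{v}+\mathbf{v}^{-1}$. Mirabolic quantum $\mathfrak{sl}_2$, denoted $MU_{\mathbf{v}}(2)$, is the unital associative $\mathbb{C}(\mathbf{v})$-algebra with generators $e,f,k,k^{-1},\ell$ and relations $kk^{-1}=k^{-1}k=1$; $kek^{-1}=\mathbf{v}^2e$; $kfk^{-1}=\mathbf{v}^{-2}f$; $ef-fe=\frac{k-k^{-1}}{\mathbf{v}-\mathbf{v}^{-1}}$; $\ell^2=\ell$; $k\ell=\ell k$; $\ell e\ell=\ell e$; $\ell f\ell=f\ell$; $[2]e\ell e=\mathbf{v}^{-1}e^2\ell+\mathbf{v}\ell e^2$; $[2]f\ell f=\mathbf{v}^{-1}\ell f^2+\mathbf{v}f^2\ell$. *)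

theory Defs
  imports
    "HOL-Library.Poly_Mapping"
    "HOL-Library.Disjoint_Sets"
    "HOL-Computational_Algebra.Polynomial"
    "HOL-Computational_Algebra.Fraction_Field"
begin

type_synonym Cv = "complex poly fract"

definition vv :: Cv where
  "vv = Fract [:0, 1:] 1"

definition qtwo :: Cv where
  "qtwo = vv + inverse vv"

datatype gen = Ge | Gf | Gk | Gkinv | Gl

text \<open>
  Words under concatenation, written additively so that the convolution product of
  \<^theory>\<open>HOL-Library.Poly_Mapping\<close> makes \<open>word \<Rightarrow>\<^sub>0 Cv\<close> the monoid algebra of the free monoid,
  that is, the free unital associative algebra.
\<close>

datatype word = Word (letters: "gen list")

instantiation word :: monoid_add
begin

definition zero_word :: word where
  "0 = Word []"

definition plus_word :: "word \<Rightarrow> word \<Rightarrow> word" where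
  "u + w = Word (letters u @ letters w)"

instance
  by standard (simp_all add: zero_word_def plus_word_def)

end

type_synonym free_alg = "word \<Rightarrow>\<^sub>0 Cv"

definition gen :: "gen \<Rightarrow> free_alg" where
  "gen g = Poly_Mapping.single (Word [g]) 1"

definition scal :: "Cv \<Rightarrow> free_alg" where
  "scal c = Poly_Mapping.single 0 c"

lemma scal_add: "scal (a + b) = scal a + scal b"
  by (simp add: scal_def single_add)

lemma scal_mult: "scal (a * b) = scal a * scal b"
  by (simp add: scal_def mult_single)

lemma scal_one: "scal 1 = 1"
  by (simp add: scal_def)

lemma scal_central: "scal c * x = x * scal c"
proof (induction x rule: update_induct)
  case const
  then show ?case by simp
next
  case (update x w a)
  have "Poly_Mapping.update w a x = x + Poly_Mapping.single w a"
    using update.hyps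
    by (intro poly_mapping_eqI) (auto simp: lookup_update lookup_add lookup_single when_def in_keys_iff)
  moreover have "scal c * Poly_Mapping.single w a = Poly_Mapping.single w a * scal c"
    by (simp add: scal_def mult_single mult.commute)
  ultimately show ?case
    using update.IH by (simp add: distrib_left distrib_right)
qed

text \<open>A pair stands for the relation equating its two components.\<close>

definition MU_relations :: "(free_alg \<times> free_alg) set" where
  "MU_relations =
    (let e = gen Ge; f = gen Gf; k = gen Gk; k' = gen Gkinv; l = gen Gl in
     {(k * k', 1),
      (k' * k, 1),
      (k * e * k', scal (vv\<^sup>2) * e),
      (k * f * k', scal (inverse (vv\<^sup>2)) * f),
      (e * f - f * e, scal (1 / (vv - inverse vv)) * (k - k')),
      (l\<^sup>2, l),
      (k * l, l * k),
      (l * e * l, l * e),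
      (l * f * l, f * l),
      (scal qtwo * (e * l * e), scal (inverse vv) * (e\<^sup>2 * l) + scal vv * (l * e\<^sup>2)),
      (scal qtwo * (f * l * f), scal (inverse vv) * (l * f\<^sup>2) + scal vv * (f\<^sup>2 * l))})"

text \<open>
  The two-sided ideal generated by a set. Since the free algebra contains the scalars,
  ring ideals are automatically closed under scalar multiplication.
\<close>

inductive_set two_sided_ideal :: "'a::ring_1 set \<Rightarrow> 'a set" for R where
  zero: "0 \<in> two_sided_ideal R"
| base: "x \<in> R \<Longrightarrow> x \<in> two_sided_ideal R"
| add: "x \<in> two_sided_ideal R \<Longrightarrow> y \<in> two_sided_ideal R \<Longrightarrow> x + y \<in> two_sided_ideal R"
| mult_left: "x \<in> two_sided_ideal R \<Longrightarrow> a * x \<in> two_sided_ideal R"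
| mult_right: "x \<in> two_sided_ideal R \<Longrightarrow> x * a \<in> two_sided_ideal R"

definition MU_ideal :: "free_alg set" where
  "MU_ideal = two_sided_ideal {x - y | x y. (x, y) \<in> MU_relations}"

lemma MU_ideal_zero: "0 \<in> MU_ideal"
  and MU_ideal_add: "x \<in> MU_ideal \<Longrightarrow> y \<in> MU_ideal \<Longrightarrow> x + y \<in> MU_ideal"
  and MU_ideal_mult_left: "x \<in> MU_ideal \<Longrightarrow> a * x \<in> MU_ideal"
  and MU_ideal_mult_right: "x \<in> MU_ideal \<Longrightarrow> x * a \<in> MU_ideal"
  by (simp_all add: MU_ideal_def two_sided_ideal.intros)

lemma MU_ideal_uminus: "x \<in> MU_ideal \<Longrightarrow> - x \<in> MU_ideal"
  using MU_ideal_mult_left[of x "- 1"] by simp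

definition MU_eq :: "free_alg \<Rightarrow> free_alg \<Rightarrow> bool" where
  "MU_eq x y \<longleftrightarrow> x - y \<in> MU_ideal"

lemma equivp_MU_eq: "equivp MU_eq"
proof (rule equivpI)
  show "reflp MU_eq"
    by (simp add: reflp_def MU_eq_def MU_ideal_zero)
  show "symp MU_eq"
    unfolding symp_def MU_eq_def using MU_ideal_uminus by fastforce
  show "transp MU_eq"
    unfolding transp_def MU_eq_def using MU_ideal_add by fastforce
qed

quotient_type MU = free_alg / MU_eq
  by (rule equivp_MU_eq)

instantiation MU :: ring
begin

lift_definition zero_MU :: MU is 0 .

lift_definition plus_MU :: "MU \<Rightarrow> MU \<Rightarrow> MU" is "(+)"
proof -
  fix x x' y y' :: free_alg
  assume "MU_eq x x'" "MU_eq y y'"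
  then have "(x - x') + (y - y') \<in> MU_ideal"
    unfolding MU_eq_def by (rule MU_ideal_add)
  then show "MU_eq (x + y) (x' + y')"
    by (simp add: MU_eq_def algebra_simps)
qed

lift_definition uminus_MU :: "MU \<Rightarrow> MU" is uminus
  unfolding MU_eq_def using MU_ideal_uminus by fastforce

lift_definition minus_MU :: "MU \<Rightarrow> MU \<Rightarrow> MU" is "(-)"
proof -
  fix x x' y y' :: free_alg
  assume "MU_eq x x'" "MU_eq y y'"
  then have "(x - x') + - (y - y') \<in> MU_ideal"
    unfolding MU_eq_def by (intro MU_ideal_add MU_ideal_uminus)
  then show "MU_eq (x - y) (x' - y')"
    by (simp add: MU_eq_def algebra_simps)
qed

lift_definition times_MU :: "MU \<Rightarrow> MU \<Rightarrow> MU" is "(*)"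
proof -
  fix x x' y y' :: free_alg
  assume "MU_eq x x'" "MU_eq y y'"
  then have "(x - x') * y + x' * (y - y') \<in> MU_ideal"
    unfolding MU_eq_def by (intro MU_ideal_add MU_ideal_mult_left MU_ideal_mult_right)
  then show "MU_eq (x * y) (x' * y')"
    by (simp add: MU_eq_def algebra_simps)
qed

instance
  by standard (transfer; simp add: algebra_simps MU_eq_def MU_ideal_zero)+

end

text \<open>
  The class \<^class>\<open>ring_1\<close> would also demand that zero and one be distinct. Instantiating
  \<^class>\<open>ring\<close> and \<^class>\<open>monoid_mult\<close> gives a unital ring without presupposing this.
\<close>

instantiation MU :: monoid_mult
begin

lift_definition one_MU :: MU is 1 .

instance
  by standard (transfer; simp add: MU_eq_def MU_ideal_zero)+

end

lift_definition MU_scale :: "Cv \<Rightarrow> MU \<Rightarrow> MU" is "\<lambda>c x. scal c * x"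
  unfolding MU_eq_def
  by (metis MU_ideal_mult_left right_diff_distrib)

global_interpretation MU: vector_space MU_scale
  by standard
    (transfer; simp add: MU_eq_def MU_ideal_zero scal_add scal_mult scal_one algebra_simps)+

lemma MU_scale_mult_left: "MU_scale c x * y = MU_scale c (x * y)"
  by transfer (simp add: MU_eq_def MU_ideal_zero mult.assoc)

lemma MU_scale_mult_right: "x * MU_scale c y = MU_scale c (x * y)"
proof transfer
  fix x y :: free_alg and c :: Cv
  have "x * (scal c * y) = scal c * (x * y)"
    by (metis mult.assoc scal_central)
  then show "MU_eq (x * (scal c * y)) (scal c * (x * y))"
    by (simp add: MU_eq_def MU_ideal_zero)
qed

lift_definition MU_gen :: "gen \<Rightarrow> MU" is gen .

abbreviation ee :: MU where "ee \<equiv> MU_gen Ge"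
abbreviation ff :: MU where "ff \<equiv> MU_gen Gf"
abbreviation kk :: MU where "kk \<equiv> MU_gen Gk"
abbreviation kkinv :: MU where "kkinv \<equiv> MU_gen Gkinv"
abbreviation ll :: MU where "ll \<equiv> MU_gen Gl"

definition kpow :: "int \<Rightarrow> MU" where
  "kpow t = (if t \<ge> 0 then kk ^ nat t else kkinv ^ nat (- t))"

datatype piece = P0 | P1 | P2 | P3 | P4 | P5

primrec index_set :: "piece \<Rightarrow> (nat \<times> nat \<times> int) set" where
  "index_set P0 = UNIV"
| "index_set P1 = UNIV"
| "index_set P2 = {(r, s, t). (r, s) \<noteq> (0, 0)}"
| "index_set P3 = {(r, s, t). r \<ge> 1 \<and> s \<ge> 1}"
| "index_set P4 = {(r, s, t). r \<ge> 1 \<and> s \<ge> 1}"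
| "index_set P5 = {(r, s, t). r \<ge> 1 \<and> s \<ge> 1}"

fun monomial :: "piece \<Rightarrow> nat \<times> nat \<times> int \<Rightarrow> MU" where
  "monomial P0 (r, s, t) = ff ^ r * ee ^ s * kpow t"
| "monomial P1 (r, s, t) = ll * ff ^ r * ee ^ s * kpow t"
| "monomial P2 (r, s, t) = ff ^ r * ee ^ s * ll * kpow t"
| "monomial P3 (r, s, t) = ll * ff ^ r * ee ^ s * ll * kpow t"
| "monomial P4 (r, s, t) = ff ^ r * ll * ee ^ s * kpow t"
| "monomial P5 (r, s, t) = ee ^ s * ll * ff ^ r * kpow t"

definition MU_B :: "piece \<Rightarrow> MU set" where
  "MU_B i = monomial i ` index_set i"

end

theory Submission
  imports Defs "HOL-Library.Function_Algebras" "HOL-Library.Product_Plus"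
begin

text \<open>
  Write \<open>U\<close> for quantum \<open>sl\<^sub>2\<close>, the algebra generated by \<open>e, f, k\<^sup>\<plusminus>\<^sup>1\<close> alone, with its basis
  \<open>f\<^sup>r e\<^sup>s k\<^sup>t\<close>.

  Independence is detected by three homomorphisms to algebras built from \<open>U\<close>. Two of them send \<open>l\<close> to 0
  and to 1 and have values in \<open>U\<close>. The third has values in the \<open>2 \<times> 2\<close> matrices over \<open>U\<close>: it is a
  coproduct of \<open>U\<close> followed by the two-dimensional simple module on the second factor, and it sends
  \<open>l\<close> to the matrix unit at (1,1) (\<open>MU_module_tensor\<close>). The product of the three
  targets has rank \<open>1 + 1 + 4 = 6\<close> over \<open>U\<close>, one for each family. Reading off its coordinates in a
  suitable order, the equations for the coefficients of a linear relation can be solved one family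
  at a time (\<open>monomial_coefficients_vanish\<close>). The factors that have to be cancelled are powers of
  \<open>v\<close> and quantum integers, nonzero because \<open>v\<close> is an indeterminate.
  The homomorphisms are realised as actions on explicit function spaces, with \<open>U\<close> replaced
  by its left regular representation, on which \<open>f\<^sup>r e\<^sup>s k\<^sup>t\<close> sends a fixed vector to a fixed
  basis vector.

  For the spanning property one shows that the span of the monomials is stable under left
  multiplication by the generators; it contains 1. Words in \<open>e, f, k\<close> alone can be ordered as
  \<open>f\<^sup>r e\<^sup>s k\<^sup>t\<close> or as \<open>e\<^sup>s f\<^sup>r k\<^sup>t\<close>. The relations \<open>lel = le\<close> and \<open>lfl = fl\<close> give \<open>le\<^sup>nl = le\<^sup>n\<close> and
  \<open>lf\<^sup>nl = f\<^sup>nl\<close>. The remaining obstruction is an \<open>l\<close> between powers of the same generator. The quadratic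
  relations say that \<open>ql - lq\<close> commutes with \<open>q\<close> up to a power of \<open>v\<close>, for \<open>q = e\<close> and \<open>q = f\<close>, and so
  \<open>q l q\<^sup>n\<close> is a combination of \<open>q\<^bsup>n+1\<^esup> l\<close> and \<open>l q\<^bsup>n+1\<^esup>\<close> (\<open>ll_between_powers\<close>).
\<close>

section \<open>Modules over the mirabolic algebra\<close>

lemma MU_relation_eq: "abs_MU x = abs_MU y" if "(x, y) \<in> MU_relations"
proof -
  have "x - y \<in> MU_ideal"
    unfolding MU_ideal_def by (rule two_sided_ideal.base) (use that in blast)
  then show ?thesis
    by (simp add: MU.abs_eq_iff MU_eq_def)
qed

lemma abs_MU_simps:
  "abs_MU (x * y) = abs_MU x * abs_MU y"
  "abs_MU (x + y) = abs_MU x + abs_MU y"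
  "abs_MU (x - y) = abs_MU x - abs_MU y"
  "abs_MU (scal c * x) = MU_scale c (abs_MU x)"
  "abs_MU 1 = 1"
  "abs_MU (gen g) = MU_gen g"
  by (simp_all add: times_MU.abs_eq plus_MU.abs_eq minus_MU.abs_eq MU_scale.abs_eq one_MU_def MU_gen.abs_eq)

lemma MU_gen_relations:
  "kk * kkinv = 1"
  "kkinv * kk = 1"
  "kk * ee * kkinv = MU_scale (vv\<^sup>2) ee"
  "kk * ff * kkinv = MU_scale (inverse (vv\<^sup>2)) ff"
  "ee * ff - ff * ee = MU_scale (1 / (vv - inverse vv)) (kk - kkinv)"
  "ll * ll = ll"
  "kk * ll = ll * kk"
  "ll * ee * ll = ll * ee"
  "ll * ff * ll = ff * ll"
  "MU_scale qtwo (ee * ll * ee) = MU_scale (inverse vv) (ee * ee * ll) + MU_scale vv (ll * (ee * ee))"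
  "MU_scale qtwo (ff * ll * ff) = MU_scale (inverse vv) (ll * (ff * ff)) + MU_scale vv (ff * ff * ll)"
  unfolding abs_MU_simps[symmetric]
  by (rule MU_relation_eq; simp add: MU_relations_def Let_def power2_eq_square)+

lemma free_alg_induct [case_names single add]:
  fixes x :: free_alg
  assumes "\<And>u c. P (Poly_Mapping.single u c)" "\<And>x y. P x \<Longrightarrow> P y \<Longrightarrow> P (x + y)"
  shows "P x"
proof (induction x rule: update_induct)
  case const
  then show ?case using assms(1)[of 0 0] by simp
next
  case (update x w a)
  have "Poly_Mapping.update w a x = x + Poly_Mapping.single w a"
    using update.hyps
    by (intro poly_mapping_eqI) (auto simp: lookup_update lookup_add lookup_single when_def in_keys_iff)
  then show ?case using update.IH assms by simp
qed

text \<open>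
  An action of the quotient algebra is the same as a choice of five operators that satisfy
  the relations. The locale collects the operators, and everything up to \<open>act\<close> serves to
  descend from the free algebra to \<^typ>\<open>MU\<close>, so that a module is given by checking relations only.
\<close>

locale MU_module = vector_space scale
  for scale :: "Cv \<Rightarrow> 'b::ab_group_add \<Rightarrow> 'b" (infixr "*s" 75) +
  fixes act_gen :: "gen \<Rightarrow> 'b \<Rightarrow> 'b"
  assumes act_gen_add: "act_gen g (w + w') = act_gen g w + act_gen g w'"
    and act_gen_scale: "act_gen g (c *s w) = c *s act_gen g w"
    and act_k_kinv: "act_gen Gk (act_gen Gkinv w) = w"
    and act_kinv_k: "act_gen Gkinv (act_gen Gk w) = w"
    and act_ke: "act_gen Gk (act_gen Ge w) = vv\<^sup>2 *s act_gen Ge (act_gen Gk w)"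
    and act_kf: "act_gen Gk (act_gen Gf w) = inverse (vv\<^sup>2) *s act_gen Gf (act_gen Gk w)"
    and act_ef: "act_gen Ge (act_gen Gf w) - act_gen Gf (act_gen Ge w)
                  = (1 / (vv - inverse vv)) *s (act_gen Gk w - act_gen Gkinv w)"
    and act_ll: "act_gen Gl (act_gen Gl w) = act_gen Gl w"
    and act_kl: "act_gen Gk (act_gen Gl w) = act_gen Gl (act_gen Gk w)"
    and act_lel: "act_gen Gl (act_gen Ge (act_gen Gl w)) = act_gen Gl (act_gen Ge w)"
    and act_lfl: "act_gen Gl (act_gen Gf (act_gen Gl w)) = act_gen Gf (act_gen Gl w)"
    and act_ele: "qtwo *s act_gen Ge (act_gen Gl (act_gen Ge w))
                  = inverse vv *s act_gen Ge (act_gen Ge (act_gen Gl w))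
                    + vv *s act_gen Gl (act_gen Ge (act_gen Ge w))"
    and act_flf: "qtwo *s act_gen Gf (act_gen Gl (act_gen Gf w))
                  = inverse vv *s act_gen Gl (act_gen Gf (act_gen Gf w))
                    + vv *s act_gen Gf (act_gen Gf (act_gen Gl w))"
begin

definition word_act :: "word \<Rightarrow> 'b \<Rightarrow> 'b" where
  "word_act u = foldr act_gen (letters u)"

definition free_act :: "free_alg \<Rightarrow> 'b \<Rightarrow> 'b" where
  "free_act x w = (\<Sum>u\<in>Poly_Mapping.keys x. Poly_Mapping.lookup x u *s word_act u w)"

lemma word_act_add_right: "word_act u (w + w') = word_act u w + word_act u w'"
proof -
  have "foldr act_gen gs (w + w') = foldr act_gen gs w + foldr act_gen gs w'" for gs
    by (induction gs) (simp_all add: act_gen_add)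
  then show ?thesis by (simp add: word_act_def)
qed

lemma word_act_scale_right: "word_act u (c *s w) = c *s word_act u w"
proof -
  have "foldr act_gen gs (c *s w) = c *s foldr act_gen gs w" for gs
    by (induction gs) (simp_all add: act_gen_scale)
  then show ?thesis by (simp add: word_act_def)
qed

lemma word_act_plus: "word_act (u + u') w = word_act u (word_act u' w)"
  by (simp add: word_act_def plus_word_def)

lemma word_act_zero [simp]: "word_act 0 w = w"
  by (simp add: word_act_def zero_word_def)

lemma free_act_superset:
  assumes "finite A" "Poly_Mapping.keys x \<subseteq> A"
  shows "free_act x w = (\<Sum>u\<in>A. Poly_Mapping.lookup x u *s word_act u w)"
  unfolding free_act_def
  by (rule sum.mono_neutral_left) (use assms in \<open>auto simp: in_keys_iff\<close>)

lemma free_act_add: "free_act (x + y) w = free_act x w + free_act y w"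
proof -
  let ?A = "Poly_Mapping.keys x \<union> Poly_Mapping.keys y"
  have "finite ?A" "Poly_Mapping.keys (x + y) \<subseteq> ?A"
    using Poly_Mapping.keys_add[of x y] by simp_all
  then show ?thesis
    by (simp add: free_act_superset[of ?A] lookup_add scale_left_distrib sum.distrib)
qed

lemma free_act_single: "free_act (Poly_Mapping.single u c) w = c *s word_act u w"
  by (subst free_act_superset[of "{u}"]) auto

lemma free_act_zero [simp]: "free_act 0 w = 0"
  by (simp add: free_act_def)

lemma free_act_uminus: "free_act (- x) w = - free_act x w"
  using free_act_add[of x "- x" w] by (simp add: eq_neg_iff_add_eq_0 add.commute)

lemma free_act_diff: "free_act (x - y) w = free_act x w - free_act y w"
  using free_act_add[of x "- y" w] by (simp add: free_act_uminus)

lemma free_act_add_right: "free_act x (w + w') = free_act x w + free_act x w'"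
  by (simp add: free_act_def word_act_add_right scale_right_distrib sum.distrib)

lemma free_act_mult: "free_act (x * y) w = free_act x (free_act y w)"
proof (induction x rule: free_alg_induct)
  case (single u c)
  show ?case
  proof (induction y rule: free_alg_induct)
    case (single u' c')
    show ?case
      by (simp add: mult_single free_act_single word_act_plus word_act_scale_right mult.commute)
  next
    case (add y y')
    show ?case
      using add by (simp add: distrib_left free_act_add free_act_add_right)
  qed
next
  case (add x x')
  then show ?case by (simp add: distrib_right free_act_add)
qed

lemma free_act_gen: "free_act (gen g) w = act_gen g w"
  by (simp add: gen_def free_act_single word_act_def)

lemma free_act_scal: "free_act (scal c) w = c *s w"
  by (simp add: scal_def free_act_single)

lemma free_act_one: "free_act 1 w = w"
  using free_act_scal[of 1] by (simp add: scal_one)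

lemma free_act_relation:
  assumes "(x, y) \<in> MU_relations"
  shows "free_act x w = free_act y w"
  using assms act_k_kinv act_kinv_k act_ke act_kf act_ef act_ll act_kl act_lel act_lfl act_ele act_flf
  unfolding MU_relations_def Let_def
  by (auto simp: free_act_mult free_act_add free_act_diff free_act_gen free_act_scal free_act_one
      power2_eq_square)

text \<open>
  The annihilator of a module is a two-sided ideal; it contains the defining relations, hence the
  ideal that they generate.
\<close>

lemma free_act_ideal: "x \<in> MU_ideal \<Longrightarrow> free_act x w = 0"
  unfolding MU_ideal_def
proof (induction x arbitrary: w rule: two_sided_ideal.induct)
  case (base x)
  then show ?case using free_act_relation by (auto simp: free_act_diff)
next
  case (mult_left x a)
  then show ?case by (metis free_act_mult free_act_zero mult_zero_right)
next
  case (mult_right x a)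
  then show ?case by (simp add: free_act_mult)
qed (simp_all add: free_act_add)

definition act :: "MU \<Rightarrow> 'b \<Rightarrow> 'b" where
  "act X = free_act (rep_MU X)"

lemma act_abs: "act (abs_MU x) w = free_act x w"
proof -
  have "MU_eq (rep_MU (abs_MU x)) x"
    using Quotient_rep_abs[OF Quotient_MU] equivp_reflp[OF equivp_MU_eq] by blast
  then show ?thesis
    using free_act_ideal[of "rep_MU (abs_MU x) - x" w]
    by (simp add: act_def MU_eq_def free_act_diff)
qed

lemma act_mult: "act (X * Y) w = act X (act Y w)"
proof (induction X; induction Y)
  fix x y show "act (abs_MU y * abs_MU x) w = act (abs_MU y) (act (abs_MU x) w)"
    by (simp add: times_MU.abs_eq act_abs free_act_mult)
qed

lemma act_add: "act (X + Y) w = act X w + act Y w"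
proof (induction X; induction Y)
  fix x y show "act (abs_MU y + abs_MU x) w = act (abs_MU y) w + act (abs_MU x) w"
    by (simp add: plus_MU.abs_eq act_abs free_act_add)
qed

lemma act_scale: "act (MU_scale c X) w = c *s act X w"
  by (induction X) (simp add: MU_scale.abs_eq act_abs free_act_mult free_act_scal)

lemma act_one: "act 1 w = w"
  by (simp add: one_MU_def act_abs free_act_one)

lemma act_MU_gen: "act (MU_gen g) w = act_gen g w"
  by (simp add: MU_gen.abs_eq act_abs free_act_gen)

lemma act_zero: "act 0 w = 0"
  by (simp add: zero_MU_def act_abs)

lemma act_sum: "act (\<Sum>j\<in>J. F j) w = (\<Sum>j\<in>J. act (F j) w)"
  by (induction J rule: infinite_finite_induct) (simp_all add: act_zero act_add)

lemma act_power: "act (X ^ n) w = (act X ^^ n) w"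
  by (induction n) (simp_all add: act_one act_mult)

lemma act_kpow:
  "act (kpow t) w = (if t \<ge> 0 then (act_gen Gk ^^ nat t) w else (act_gen Gkinv ^^ nat (- t)) w)"
proof -
  have "act (MU_gen g) = act_gen g" for g by (simp add: fun_eq_iff act_MU_gen)
  then show ?thesis by (simp add: kpow_def act_power)
qed

end

section \<open>Quantum integers\<close>

lemma vv_power: "vv ^ n = Fract (monom 1 n) 1"
proof (induction n)
  case 0
  then show ?case by (simp add: One_fract_def)
next
  case (Suc n)
  have "[:0, 1:] = (monom 1 1 :: complex poly)"
    by (simp add: monom_altdef)
  with Suc show ?case by (simp add: vv_def mult_monom)
qed

lemma vv_nonzero [simp]: "vv \<noteq> 0"
  by (simp add: vv_def Zero_fract_def eq_fract)

text \<open>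
  The only arithmetic input about the base field: the indeterminate is not a root of unity, so
  that the quantum integers for \<open>n > 0\<close> do not vanish.
\<close>

lemma vv_power_neq_1: "n > 0 \<Longrightarrow> vv ^ n \<noteq> 1"
  unfolding vv_power One_fract_def
  by (simp add: eq_fract) (metis degree_1 degree_monom_eq less_numeral_extra(3) zero_neq_one)

lemma vv_diff_nonzero [simp]: "vv - inverse vv \<noteq> 0"
proof
  assume "vv - inverse vv = 0"
  then have "vv * vv = 1" by (metis eq_iff_diff_eq_0 right_inverse vv_nonzero)
  then show False using vv_power_neq_1[of 2] by (simp add: power2_eq_square)
qed

text \<open>
  Quantum integers in the normalisation \<open>1 + q + \<dots> + q\<^bsup>n-1\<^esup>\<close>. With \<open>q = v\<^sup>-\<^sup>2\<close> and
  \<open>q = v\<^sup>2\<close> they differ from the symmetric ones by a power of \<open>v\<close>.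
\<close>

definition qn :: "Cv \<Rightarrow> nat \<Rightarrow> Cv" where
  "qn q n = (\<Sum>i<n. q ^ i)"

lemma qn_0 [simp]: "qn q 0 = 0"
  and qn_Suc: "qn q (Suc n) = qn q n + q ^ n"
  by (simp_all add: qn_def)

lemma qn_Suc': "qn q (Suc n) = 1 + q * qn q n"
proof (induction n)
  case (Suc n)
  then have "1 + q * qn q (Suc n) = 1 + q * (qn q n + q ^ n)"
    by (simp add: qn_Suc)
  also have "\<dots> = qn q (Suc n) + q ^ Suc n"
    using Suc by (simp add: algebra_simps)
  finally show ?case by (simp add: qn_Suc)
qed (simp add: qn_Suc)

lemma qn_geometric: "qn q n * (q - 1) = q ^ n - 1"
  by (induction n) (simp_all add: qn_Suc algebra_simps)

lemma qn_vv_nonzero: "n > 0 \<Longrightarrow> qn (vv\<^sup>2) n \<noteq> 0"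
  using qn_geometric[of "vv\<^sup>2" n] vv_power_neq_1[of "2 * n"] by (auto simp: power_mult)

lemma qn_inverse_vv_nonzero: "n > 0 \<Longrightarrow> qn (inverse (vv\<^sup>2)) n \<noteq> 0"
  using qn_geometric[of "inverse (vv\<^sup>2)" n] vv_power_neq_1[of "2 * n"]
  by (auto simp: power_mult power_inverse)

section \<open>Modules over quantum sl2 and their mirabolic structures\<close>

text \<open>
  Modules over quantum \<open>sl\<^sub>2\<close>, again given by operators: the algebra enters only through
  its modules.
\<close>

locale U_module = vector_space scale
  for scale :: "Cv \<Rightarrow> 'b::ab_group_add \<Rightarrow> 'b" (infixr "*s" 75) +
  fixes e f k k' :: "'b \<Rightarrow> 'b"
  assumes add: "h \<in> {e, f, k, k'} \<Longrightarrow> h (w + w') = h w + h w'"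
    and scale: "h \<in> {e, f, k, k'} \<Longrightarrow> h (c *s w) = c *s h w"
    and k_k': "k (k' w) = w"
    and k'_k: "k' (k w) = w"
    and k_e: "k (e w) = vv\<^sup>2 *s e (k w)"
    and k_f: "k (f w) = inverse (vv\<^sup>2) *s f (k w)"
    and e_f: "e (f w) = f (e w) + (1 / (vv - inverse vv)) *s (k w - k' w)"
begin

lemma op_add [simp]:
  "e (x + y) = e x + e y" "f (x + y) = f x + f y" "k (x + y) = k x + k y" "k' (x + y) = k' x + k' y"
  by (simp_all add: add)

lemma op_scale [simp]:
  "e (c *s x) = c *s e x" "f (c *s x) = c *s f x" "k (c *s x) = c *s k x" "k' (c *s x) = c *s k' x"
  by (simp_all add: scale)

lemma preserves_zero [simp]: "e 0 = 0" "f 0 = 0" "k 0 = 0" "k' 0 = 0"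
  using op_scale[of 0 0] by simp_all

lemma powers_zero [simp]: "(e ^^ n) 0 = 0" "(f ^^ n) 0 = 0"  "(k ^^ n) 0 = 0"  "(k' ^^ n) 0 = 0"
  by (induction n) simp_all

lemma powers_scale:
  "(e ^^ n) (c *s x) = c *s (e ^^ n) x" "(f ^^ n) (c *s x) = c *s (f ^^ n) x"
  "(k ^^ n) (c *s x) = c *s (k ^^ n) x" "(k' ^^ n) (c *s x) = c *s (k' ^^ n) x"
  by (induction n) simp_all

lemma powers_add:
  "(e ^^ n) (x + y) = (e ^^ n) x + (e ^^ n) y" "(f ^^ n) (x + y) = (f ^^ n) x + (f ^^ n) y"
  by (induction n) simp_all

lemma k'_e: "k' (e w) = inverse (vv\<^sup>2) *s e (k' w)"
proof -
  have "vv\<^sup>2 *s k' (e w) = vv\<^sup>2 *s k' (e (k (k' w)))"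
    by (simp add: k_k')
  also have "\<dots> = k' (k (e (k' w)))"
    by (simp add: k_e)
  finally have "vv\<^sup>2 *s k' (e w) = e (k' w)"
    by (simp add: k'_k)
  then have "inverse (vv\<^sup>2) *s vv\<^sup>2 *s k' (e w) = inverse (vv\<^sup>2) *s e (k' w)" by simp
  then show ?thesis by simp
qed

lemma k'_f: "k' (f w) = vv\<^sup>2 *s f (k' w)"
proof -
  have "inverse (vv\<^sup>2) *s k' (f w) = inverse (vv\<^sup>2) *s k' (f (k (k' w)))"
    by (simp add: k_k')
  also have "\<dots> = k' (k (f (k' w)))"
    by (simp add: k_f)
  finally have "inverse (vv\<^sup>2) *s k' (f w) = f (k' w)"
    by (simp add: k'_k)
  then have "vv\<^sup>2 *s inverse (vv\<^sup>2) *s k' (f w) = vv\<^sup>2 *s f (k' w)" by simp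
  then show ?thesis by simp
qed

lemma k'_e_power: "k' ((e ^^ n) w) = (inverse (vv\<^sup>2)) ^ n *s (e ^^ n) (k' w)"
  by (induction n) (simp_all add: k'_e mult.commute)

text \<open>
  The Chevalley involution exchanges \<open>e\<close> with \<open>f\<close> and \<open>k\<close> with \<open>k\<^sup>-\<^sup>1\<close>. It turns statements about
  the order \<open>f\<^sup>r e\<^sup>s\<close> into statements about the order \<open>e\<^sup>s f\<^sup>r\<close>.
\<close>

lemma twist: "U_module scale f e k' k"
proof
  fix w
  have "(1 / (vv - inverse vv)) *s (k' w - k w) = - ((1 / (vv - inverse vv)) *s (k w - k' w))"
    by (simp flip: scale_minus_right)
  then show "f (e w) = e (f w) + (1 / (vv - inverse vv)) *s (k' w - k w)"
    by (simp add: e_f)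
qed (auto simp: k'_e k'_f k_k' k'_k)

definition kp :: "int \<Rightarrow> 'b \<Rightarrow> 'b" where
  "kp t w = (if t \<ge> 0 then (k ^^ nat t) w else (k' ^^ nat (- t)) w)"

lemma kp_zero [simp]: "kp t 0 = 0"
  by (simp add: kp_def)

text \<open>
  Every relation that involves \<open>l\<close> holds trivially for \<open>l = 0\<close>, and for \<open>l = 1\<close> the last two reduce
  to \<open>[2] = v + v\<^sup>-\<^sup>1\<close>. Hence a \<open>U\<close>-module is a module over the mirabolic algebra in two ways.
\<close>

lemma MU_module_l_zero: "MU_module scale (case_gen e f k k' (\<lambda>_. 0))"
proof
  fix g w w' show "case_gen e f k k' (\<lambda>_. 0) g (w + w')
    = case_gen e f k k' (\<lambda>_. 0) g w + case_gen e f k k' (\<lambda>_. 0) g w'"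
    by (cases g) simp_all
next
  fix g c w show "case_gen e f k k' (\<lambda>_. 0) g (c *s w) = c *s case_gen e f k k' (\<lambda>_. 0) g w"
    by (cases g) simp_all
qed (simp_all add: k_k' k'_k k_e k_f e_f)

lemma MU_module_l_one: "MU_module scale (case_gen e f k k' (\<lambda>w. w))"
proof
  fix g w w' show "case_gen e f k k' (\<lambda>w. w) g (w + w')
    = case_gen e f k k' (\<lambda>w. w) g w + case_gen e f k k' (\<lambda>w. w) g w'"
    by (cases g) simp_all
next
  fix g c w show "case_gen e f k k' (\<lambda>w. w) g (c *s w) = c *s case_gen e f k k' (\<lambda>w. w) g w"
    by (cases g) simp_all
qed (simp_all add: k_k' k'_k k_e k_f e_f qtwo_def add.commute flip: scale_left_distrib)

text \<open>
  The third way: a pair \<open>(x, y)\<close> stands for \<open>x \<otimes> v\<^sub>1 + y \<otimes> v\<^sub>2\<close> in the tensor product with the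
  two-dimensional simple module, where \<open>e v\<^sub>1 = v\<^sub>2\<close>, \<open>f v\<^sub>2 = v\<^sub>1\<close> and \<open>k\<close> has the eigenvalues
  \<open>v\<^sup>-\<^sup>1, v\<close>. The coproduct is \<open>e \<mapsto> e \<otimes> 1 + k\<^sup>-\<^sup>1 \<otimes> e\<close>, \<open>f \<mapsto> f \<otimes> k + 1 \<otimes> f\<close>, \<open>k \<mapsto> k \<otimes> k\<close>,
  and \<open>l\<close> projects onto \<open>v\<^sub>1\<close>. The relations \<open>lel = le\<close> and \<open>lfl = fl\<close> say that \<open>e\<close> is lower and
  \<open>f\<close> upper triangular in this basis. The quadratic relations fix the coproduct: with \<open>k\<close> in place
  of \<open>k\<^sup>-\<^sup>1\<close> in the image of \<open>e\<close>, the relation for \<open>e l e\<close> would fail.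
\<close>

definition scale2 :: "Cv \<Rightarrow> 'b \<times> 'b \<Rightarrow> 'b \<times> 'b" where
  "scale2 c = map_prod (scale c) (scale c)"

lemma scale2_simps: "fst (scale2 c w) = c *s fst w" "snd (scale2 c w) = c *s snd w"
  by (simp_all add: scale2_def)

definition e2 :: "'b \<times> 'b \<Rightarrow> 'b \<times> 'b" where
  "e2 = (\<lambda>(x, y). (e x, k' x + e y))"

definition f2 :: "'b \<times> 'b \<Rightarrow> 'b \<times> 'b" where
  "f2 = (\<lambda>(x, y). (inverse vv *s f x + y, vv *s f y))"

definition k2 :: "'b \<times> 'b \<Rightarrow> 'b \<times> 'b" where
  "k2 = (\<lambda>(x, y). (inverse vv *s k x, vv *s k y))"

definition k2' :: "'b \<times> 'b \<Rightarrow> 'b \<times> 'b" where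
  "k2' = (\<lambda>(x, y). (vv *s k' x, inverse vv *s k' y))"

definition l2 :: "'b \<times> 'b \<Rightarrow> 'b \<times> 'b" where
  "l2 = (\<lambda>(x, y). (x, 0))"

lemmas ops2_def = e2_def f2_def k2_def k2'_def l2_def

abbreviation ops2 :: "gen \<Rightarrow> 'b \<times> 'b \<Rightarrow> 'b \<times> 'b" where
  "ops2 \<equiv> case_gen e2 f2 k2 k2' l2"

lemma MU_module_tensor: "MU_module scale2 ops2"
proof
  fix g c and w w' :: "'b \<times> 'b"
  show "ops2 g (w + w') = ops2 g w + ops2 g w'"
    by (cases g) (auto simp: ops2_def scale_right_distrib split: prod.splits)
  show "ops2 g (scale2 c w) = scale2 c (ops2 g w)"
    by (cases g) (auto simp: ops2_def scale2_def scale_right_distrib mult.commute split: prod.splits)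
next
  fix w :: "'b \<times> 'b"
  obtain x y where w: "w = (x, y)" by force
  define d where "d = vv - inverse vv"
  (* The correction terms k' x and k' y have coefficient 1; this splits them over the denominator d. *)
  have split: "z = (vv / d) *s z - (inverse vv / d) *s z" for z
  proof -
    have "vv / d - inverse vv / d = 1"
      using vv_diff_nonzero by (simp add: d_def flip: diff_divide_distrib)
    then show ?thesis by (metis scale_left_diff_distrib scale_one)
  qed
  have "inverse vv *s e (f x) + e y - (inverse vv *s f (e x) + (k' x + e y))
      = (inverse vv / d) *s k x - (inverse vv / d) *s k' x - k' x"
    by (simp add: e_f d_def scale_right_distrib scale_right_diff_distrib)
  also have "\<dots> = (inverse vv / d) *s k x - (vv / d) *s k' x"
    using split[of "k' x"] by (simp add: algebra_simps)
  finally have 1: "inverse vv *s e (f x) + e y - (inverse vv *s f (e x) + (k' x + e y))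
      = (inverse vv / d) *s k x - (vv / d) *s k' x" .
  have "inverse vv *s k' (f x) + k' y + vv *s e (f y) - (vv *s f (k' x) + vv *s f (e y))
      = (vv / d) *s k y - (vv / d) *s k' y + k' y"
    by (simp add: e_f k'_f d_def scale_right_distrib scale_right_diff_distrib power2_eq_square)
  also have "\<dots> = (vv / d) *s k y - (inverse vv / d) *s k' y"
    using split[of "k' y"] by (simp add: algebra_simps)
  finally have 2: "inverse vv *s k' (f x) + k' y + vv *s e (f y) - (vv *s f (k' x) + vv *s f (e y))
      = (vv / d) *s k y - (inverse vv / d) *s k' y" .
  show "ops2 Ge (ops2 Gf w) - ops2 Gf (ops2 Ge w)
      = scale2 (1 / (vv - inverse vv)) (ops2 Gk w - ops2 Gkinv w)"
    using 1 2
    by (simp add: w ops2_def scale2_def scale_right_distrib scale_right_diff_distrib flip: d_def)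
  show "scale2 qtwo (ops2 Ge (ops2 Gl (ops2 Ge w)))
      = scale2 (inverse vv) (ops2 Ge (ops2 Ge (ops2 Gl w))) + scale2 vv (ops2 Gl (ops2 Ge (ops2 Ge w)))"
    by (simp add: w ops2_def scale2_def scale_right_distrib k'_e qtwo_def power2_eq_square add.commute
        distrib_right flip: scale_left_distrib)
  show "scale2 qtwo (ops2 Gf (ops2 Gl (ops2 Gf w)))
      = scale2 (inverse vv) (ops2 Gl (ops2 Gf (ops2 Gf w))) + scale2 vv (ops2 Gf (ops2 Gf (ops2 Gl w)))"
  proof -
    have "vv * (inverse vv * inverse vv) = inverse vv"
      by (simp flip: mult.assoc)
    then show ?thesis
      by (simp add: w ops2_def scale2_def scale_right_distrib scale_left_distrib qtwo_def add_ac mult_ac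
          distrib_left)
  qed
qed (auto simp: ops2_def scale2_def scale_right_distrib scale_left_distrib k_k' k'_k k_e k_f
    power2_eq_square mult.assoc split: prod.splits)

lemma l2_apply: "l2 (x, y) = (x, 0)"
  by (simp add: l2_def)

text \<open>
  The off-diagonal entry of \<open>e\<^sup>n\<close> is \<open>\<Sum> e\<^sup>i k\<^sup>-\<^sup>1 e\<^bsup>n-1-i\<^esup>\<close>; moving \<open>k\<^sup>-\<^sup>1\<close> to the right makes it a
  quantum integer times one monomial. For \<open>n = 0\<close> the quantum integer is 0, so the truncated
  exponent does no harm. The same happens for \<open>f\<^sup>n\<close> below.
\<close>

lemma e2_power:
  "(e2 ^^ n) (x, y) = ((e ^^ n) x, qn (inverse (vv\<^sup>2)) n *s (e ^^ (n - 1)) (k' x) + (e ^^ n) y)"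
proof (induction n)
  case (Suc n)
  then show ?case
    by (cases n) (simp_all add: e2_def k'_e_power k'_e qn_Suc scale_left_distrib add_ac)
qed simp

lemma f2_power:
  "(f2 ^^ n) (x, y) = ((inverse vv) ^ n *s (f ^^ n) x
   + (vv ^ (n - 1) * qn (inverse (vv\<^sup>2)) n) *s (f ^^ (n - 1)) y,
   vv ^ n *s (f ^^ n) y)"
proof (induction n)
  case (Suc n)
  have "vv ^ n * qn (inverse (vv\<^sup>2)) (Suc n) = inverse vv * (vv ^ (n - 1) * qn (inverse (vv\<^sup>2)) n) + vv ^ n"
    by (cases n) (simp_all add: qn_Suc' field_simps power2_eq_square)
  with Suc show ?case
    by (cases n) (simp_all add: f2_def scale_right_distrib scale_left_distrib add_ac mult_ac)
qed simp

lemma k2_power: "(k2 ^^ n) (x, y) = (inverse vv ^ n *s (k ^^ n) x, vv ^ n *s (k ^^ n) y)"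
  by (induction n) (simp_all add: k2_def)

lemma k2'_power: "(k2' ^^ n) (x, y) = (vv ^ n *s (k' ^^ n) x, inverse vv ^ n *s (k' ^^ n) y)"
  by (induction n) (simp_all add: k2'_def)

end

sublocale U_module \<subseteq> tensor: MU_module scale2 ops2
  by (rule MU_module_tensor)

context U_module
begin

lemma tensor_kpow: "tensor.act (kpow t) (x, y) = ((vv powi (- t)) *s kp t x, (vv powi t) *s kp t y)"
  by (simp add: tensor.act_kpow k2_power k2'_power kp_def power_int_def)

end

section \<open>The regular representation of quantum sl2\<close>

text \<open>
  The left regular representation of quantum \<open>sl\<^sub>2\<close> in its Poincare-Birkhoff-Witt basis. A function
  on the index triples is the (possibly infinite) formal combination \<open>\<Sum> g(r,s,t) f\<^sup>r e\<^sup>s k\<^sup>t\<close>, and the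
  operators below are read off from
  \<open>k f\<^sup>r e\<^sup>s k\<^sup>t = v\<^bsup>2s-2r\<^esup> f\<^sup>r e\<^sup>s k\<^bsup>t+1\<^esup>\<close> and
  \<open>e f\<^sup>r = f\<^sup>r e + [r] f\<^bsup>r-1\<^esup> (v\<^bsup>1-r\<^esup> k - v\<^bsup>r-1\<^esup> k\<^sup>-\<^sup>1) / (v - v\<^sup>-\<^sup>1)\<close>. Each value of the
  image involves finitely many values of \<open>g\<close>, so the formulas make sense for all \<open>g\<close>. That
  these operators satisfy the relations amounts to the basis theorem for quantum \<open>sl\<^sub>2\<close>.
\<close>

type_synonym U_fun = "nat \<times> nat \<times> int \<Rightarrow> Cv"

definition fun_scale :: "Cv \<Rightarrow> U_fun \<Rightarrow> U_fun" where
  "fun_scale c g = (\<lambda>p. c * g p)"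

definition reg_f :: "U_fun \<Rightarrow> U_fun" where
  "reg_f g = (\<lambda>(r, s, t). case r of 0 \<Rightarrow> 0 | Suc r' \<Rightarrow> g (r', s, t))"

definition reg_k :: "U_fun \<Rightarrow> U_fun" where
  "reg_k g = (\<lambda>(r, s, t). vv ^ (2 * s) / vv ^ (2 * r) * g (r, s, t - 1))"

definition reg_k' :: "U_fun \<Rightarrow> U_fun" where
  "reg_k' g = (\<lambda>(r, s, t). vv ^ (2 * r) / vv ^ (2 * s) * g (r, s, t + 1))"

definition reg_e :: "U_fun \<Rightarrow> U_fun" where
  "reg_e g = (\<lambda>(r, s, t). (case s of 0 \<Rightarrow> 0 | Suc s' \<Rightarrow> g (r, s', t))
     + (vv ^ Suc r - inverse vv ^ Suc r) / (vv - inverse vv)\<^sup>2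
       * (vv ^ (2 * s) / vv ^ r * g (Suc r, s, t - 1) - vv ^ r / vv ^ (2 * s) * g (Suc r, s, t + 1)))"

lemmas reg_defs = reg_f_def reg_k_def reg_k'_def reg_e_def

text \<open>
  The scalar identity behind \<open>ef - fe\<close> on \<open>f\<^sup>r e\<^sup>s k\<^sup>t\<close>, with \<open>a = v\<^sup>r\<close> and \<open>b = v\<^bsup>2s\<^esup>\<close>: both
  sides are compared as linear forms in \<open>x\<close> and \<open>y\<close>, which are the values at \<open>t - 1\<close> and \<open>t + 1\<close>.
\<close>

lemma commutator_coefficients:
  fixes a b v d x y :: "'a::field"
  assumes nz: "a \<noteq> 0" "b \<noteq> 0" "v \<noteq> 0" "d \<noteq> 0" and d: "d = v - inverse v"
  shows "(a * v - inverse (a * v)) / d\<^sup>2 * (b / a * x - a / b * y)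
    = (a - inverse a) / d\<^sup>2 * (b * v / a * x - a / (b * v) * y) + 1 / d * (b / a\<^sup>2 * x - a\<^sup>2 / b * y)"
proof -
  have x: "(a * v - inverse (a * v)) * (b / a) - (a - inverse a) * (b * v / a) = d * (b / a\<^sup>2)"
    using nz(1-3) by (simp add: d field_simps power2_eq_square)
  have y: "(a * v - inverse (a * v)) * (a / b) - (a - inverse a) * (a / (b * v)) = d * (a\<^sup>2 / b)"
    using nz(1-3) by (simp add: d field_simps power2_eq_square)
  have "(a * v - inverse (a * v)) * (b / a * x - a / b * y) - (a - inverse a) * (b * v / a * x - a / (b * v) * y)
    = ((a * v - inverse (a * v)) * (b / a) - (a - inverse a) * (b * v / a)) * x
      - ((a * v - inverse (a * v)) * (a / b) - (a - inverse a) * (a / (b * v))) * y"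
    by (simp only: ring_distribs mult.assoc) simp
  also have "\<dots> = d * (b / a\<^sup>2 * x - a\<^sup>2 / b * y)"
    unfolding x y by (simp add: algebra_simps)
  finally have "(a * v - inverse (a * v)) * (b / a * x - a / b * y)
    = (a - inverse a) * (b * v / a * x - a / (b * v) * y) + d * (b / a\<^sup>2 * x - a\<^sup>2 / b * y)"
    by (simp add: diff_eq_eq add.commute)
  then have "(a * v - inverse (a * v)) * (b / a * x - a / b * y) / d\<^sup>2
    = (a - inverse a) * (b * v / a * x - a / (b * v) * y) / d\<^sup>2 + d * (b / a\<^sup>2 * x - a\<^sup>2 / b * y) / d\<^sup>2"
    by (simp only: add_divide_distrib)
  then show ?thesis
    using nz(4) by (simp add: power2_eq_square)
qed

interpretation regular: U_module fun_scale reg_e reg_f reg_k reg_k'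
proof
  have *: "reg_e (reg_f w) (r, s, t)
      = (reg_f (reg_e w) + fun_scale (1 / (vv - inverse vv)) (reg_k w - reg_k' w)) (r, s, t)" for w r s t
  proof -
    define a b d where "a = vv ^ r" and "b = vv ^ (2 * s)" and "d = vv - inverse vv"
    have nz: "a \<noteq> 0" "b \<noteq> 0" "vv \<noteq> 0" "d \<noteq> 0" using vv_diff_nonzero by (simp_all add: a_def b_def d_def)
    define X where "X = (case s of 0 \<Rightarrow> 0 | Suc s' \<Rightarrow> reg_f w (r, s', t))"
    define R where "R = (a - inverse a) / d\<^sup>2 * (b * vv / a * w (r, s, t - 1) - a / (b * vv) * w (r, s, t + 1))"
    have reg_f_Suc: "reg_f w (Suc r, s', t') = w (r, s', t')" for s' t'
      by (simp add: reg_f_def)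
    have 1: "reg_e (reg_f w) (r, s, t)
        = X + (a * vv - inverse (a * vv)) / d\<^sup>2 * (b / a * w (r, s, t - 1) - a / b * w (r, s, t + 1))"
      by (simp add: reg_e_def X_def a_def b_def d_def reg_f_Suc power_inverse mult.commute)
    have 2: "reg_f (reg_e w) (r, s, t) = X + R"
    proof (cases r)
      (* Here R = 0, because a = 1. *)
      case 0
      then show ?thesis by (simp add: reg_f_def X_def R_def a_def split: nat.split)
    next
      case (Suc r')
      have "b * vv / a = b / vv ^ r'" "a / (b * vv) = vv ^ r' / b"
        using nz by (simp_all add: a_def Suc)
      then have "R = (a - inverse a) / d\<^sup>2 * (b / vv ^ r' * w (r, s, t - 1) - vv ^ r' / b * w (r, s, t + 1))"
        by (simp only: R_def)
      then show ?thesis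
        by (simp add: reg_f_def reg_e_def X_def a_def b_def d_def Suc power_inverse split: nat.split)
    qed
    have 3: "fun_scale (1 / (vv - inverse vv)) (reg_k w - reg_k' w) (r, s, t)
        = 1 / d * (b / a\<^sup>2 * w (r, s, t - 1) - a\<^sup>2 / b * w (r, s, t + 1))"
      by (simp add: fun_scale_def reg_k_def reg_k'_def a_def b_def d_def mult.commute flip: power_mult)
    show ?thesis
      using commutator_coefficients[OF nz d_def] by (simp add: 1 2 3 R_def)
  qed
  fix w show "reg_e (reg_f w) = reg_f (reg_e w) + fun_scale (1 / (vv - inverse vv)) (reg_k w - reg_k' w)"
    using * by fastforce
  show "reg_k (reg_k' w) = w" "reg_k' (reg_k w) = w"
    by (auto simp: reg_defs)
  show "reg_k (reg_f w) = fun_scale (inverse (vv\<^sup>2)) (reg_f (reg_k w))"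
    by (auto simp: reg_defs fun_scale_def fun_eq_iff field_simps power2_eq_square split: nat.splits)
  show "reg_k (reg_e w) = fun_scale (vv\<^sup>2) (reg_e (reg_k w))"
  proof (rule ext, clarify)
    fix r s t
    define a b m n q where "a = vv ^ (2 * r)" and "b = vv ^ (2 * s)"
      and "m = vv ^ (2 * s) / vv ^ r" and "n = vv ^ r / vv ^ (2 * s)"
      and "q = (vv ^ Suc r - inverse vv ^ Suc r) / (vv - inverse vv)\<^sup>2"
    define X Y where "X = (case s of 0 \<Rightarrow> 0 | Suc s' \<Rightarrow> w (r, s', t - 1))"
      and "Y = (case s of 0 \<Rightarrow> 0 | Suc s' \<Rightarrow> reg_k w (r, s', t))"
    have Y: "vv\<^sup>2 * Y = b / a * X"
      by (cases s) (simp_all add: X_def Y_def reg_k_def a_def b_def power2_eq_square)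
    have Z: "vv\<^sup>2 * reg_k w (Suc r, s, t') = b / a * w (Suc r, s, t' - 1)" for t'
      by (simp add: reg_k_def a_def b_def power2_eq_square)
    have "fun_scale (vv\<^sup>2) (reg_e (reg_k w)) (r, s, t)
        = vv\<^sup>2 * (Y + q * (m * reg_k w (Suc r, s, t - 1) - n * reg_k w (Suc r, s, t + 1)))"
      by (simp add: fun_scale_def reg_e_def Y_def q_def m_def n_def)
    also have "\<dots> = vv\<^sup>2 * Y + q * (m * (vv\<^sup>2 * reg_k w (Suc r, s, t - 1))
        - n * (vv\<^sup>2 * reg_k w (Suc r, s, t + 1)))"
      by (simp add: algebra_simps)
    also have "\<dots> = b / a * (X + q * (m * w (Suc r, s, t - 1 - 1) - n * w (Suc r, s, t + 1 - 1)))"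
      unfolding Y Z by (simp add: algebra_simps)
    also have "\<dots> = reg_k (reg_e w) (r, s, t)"
      by (simp add: reg_k_def reg_e_def X_def a_def b_def q_def m_def n_def)
    finally show "reg_k (reg_e w) (r, s, t) = fun_scale (vv\<^sup>2) (reg_e (reg_k w)) (r, s, t)" ..
  qed
next
  fix h w w' assume "h \<in> {reg_e, reg_f, reg_k, reg_k'}"
  then show "h (w + w') = h w + h w'"
    by (elim insertE emptyE; hypsubst)
      (simp_all add: reg_defs fun_eq_iff ring_distribs add_divide_distrib add_ac split: nat.splits)
next
  fix h c w assume "h \<in> {reg_e, reg_f, reg_k, reg_k'}"
  then show "h (fun_scale c w) = fun_scale c (h w)"
    by (elim insertE emptyE; hypsubst)
      (simp_all add: reg_defs fun_scale_def fun_eq_iff ring_distribs mult_ac split: nat.splits)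
qed (auto simp: fun_scale_def fun_eq_iff algebra_simps)

interpretation twisted: U_module fun_scale reg_f reg_e reg_k' reg_k
  by (rule regular.twist)

definition delta :: "nat \<times> nat \<times> int \<Rightarrow> U_fun" where
  "delta p = (\<lambda>q. if q = p then 1 else 0)"

lemma reg_f_delta: "reg_f (delta (r, s, t)) = delta (Suc r, s, t)"
  by (auto simp: reg_f_def delta_def fun_eq_iff split: nat.splits)

lemma reg_e_delta: "reg_e (delta (0, s, t)) = delta (0, Suc s, t)"
  by (auto simp: reg_e_def delta_def fun_eq_iff split: nat.splits)

lemma reg_k_delta: "reg_k (delta (0, s, t)) = fun_scale (vv ^ (2 * s)) (delta (0, s, t + 1))"
  by (auto simp: reg_k_def delta_def fun_scale_def fun_eq_iff)

lemma reg_k'_delta: "reg_k' (delta (0, 0, t)) = delta (0, 0, t - 1)"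
  by (auto simp: reg_k'_def delta_def fun_eq_iff)

lemma reg_f_power_delta: "(reg_f ^^ n) (delta (r, s, t)) = delta (n + r, s, t)"
  by (induction n) (simp_all add: reg_f_delta)

lemma reg_e_power_delta: "(reg_e ^^ n) (delta (0, s, t)) = delta (0, n + s, t)"
  by (induction n) (simp_all add: reg_e_delta)

lemma reg_k_power_delta: "(reg_k ^^ n) (delta (0, 0, t)) = delta (0, 0, t + int n)"
  by (induction n) (simp_all add: reg_k_delta algebra_simps)

lemma reg_k'_power_delta: "(reg_k' ^^ n) (delta (0, 0, t)) = delta (0, 0, t - int n)"
  by (induction n) (simp_all add: reg_k'_delta algebra_simps)

lemma regular_kp_delta: "regular.kp t (delta (0, 0, 0)) = delta (0, 0, t)"
  by (simp add: regular.kp_def reg_k_power_delta reg_k'_power_delta)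

lemma twisted_kp_delta: "twisted.kp t (delta (0, 0, 0)) = delta (0, 0, - t)"
  by (simp add: twisted.kp_def reg_k_power_delta reg_k'_power_delta)

abbreviation v0 :: U_fun where "v0 \<equiv> delta (0, 0, 0)"

interpretation l_zero: MU_module fun_scale "case_gen reg_e reg_f reg_k reg_k' (\<lambda>_. 0)"
  by (rule regular.MU_module_l_zero)

interpretation l_one: MU_module fun_scale "case_gen reg_e reg_f reg_k reg_k' (\<lambda>w. w)"
  by (rule regular.MU_module_l_one)

lemma act_gen_fun: "l_zero.act (MU_gen g) = case_gen reg_e reg_f reg_k reg_k' (\<lambda>_. 0) g"
   "l_one.act (MU_gen g) = case_gen reg_e reg_f reg_k reg_k' (\<lambda>w. w) g"
  "regular.tensor.act (MU_gen g) = regular.ops2 g"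
  "twisted.tensor.act (MU_gen g) = twisted.ops2 g"
  by (simp_all add: fun_eq_iff l_zero.act_MU_gen l_one.act_MU_gen regular.tensor.act_MU_gen twisted.tensor.act_MU_gen)

lemma l_zero_monomial: "l_zero.act (monomial i (r, s, t)) v0 = (if i = P0 then delta (r, s, t) else 0)"
proof -
  have kp: "l_zero.act (kpow t) v0 = delta (0, 0, t)"
    by (simp only: l_zero.act_kpow gen.case regular_kp_delta[unfolded regular.kp_def])
  show ?thesis
    by (cases i)
      (simp_all add: l_zero.act_mult l_zero.act_power act_gen_fun kp
        reg_e_power_delta reg_f_power_delta)
qed

lemma l_one_monomial: "l_one.act (monomial i (r, s, t)) v0 = delta (r, s, t)" if "i \<noteq> P5"
proof -
  have kp: "l_one.act (kpow t) v0 = delta (0, 0, t)"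
    by (simp only: l_one.act_kpow gen.case regular_kp_delta[unfolded regular.kp_def])
  show ?thesis
    using that by (cases i)
      (simp_all add: l_one.act_mult l_one.act_power act_gen_fun kp
        reg_e_power_delta reg_f_power_delta)
qed

text \<open>
  The off-diagonal coefficients of \<open>e\<^sup>s\<close> and \<open>f\<^sup>r\<close>. The second one is the symmetric quantum integer
  \<open>[r]\<close>.
\<close>

abbreviation alpha :: "nat \<Rightarrow> Cv" where "alpha \<equiv> qn (inverse (vv\<^sup>2))"
abbreviation beta :: "nat \<Rightarrow> Cv" where "beta r \<equiv> vv ^ (r - 1) * alpha r"

text \<open>
  The matrix entry (2,2). A monomial that ends in \<open>l\<close> kills \<open>v\<^sub>2\<close>, one that begins with \<open>l\<close> has no
  component at \<open>v\<^sub>2\<close>, and \<open>f\<^sup>r l e\<^sup>s\<close> kills \<open>v\<^sub>2\<close> because \<open>e\<^sup>s\<close> does not leave the multiples of \<open>v\<^sub>2\<close>.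
  What is left is \<open>e\<^sup>s l f\<^sup>r\<close>, with an entry that carries \<open>e\<close> to the left of \<open>f\<close>. In the twisted
  regular representation this entry is a multiple of a single basis vector.
\<close>

lemma snd_twisted_tensor_second:
  assumes "i \<noteq> P0"
  shows "snd (twisted.tensor.act (monomial i (r, s, t)) (0, v0))
    = (if i = P5 then fun_scale (vv powi t * (alpha s * (beta r * vv ^ (2 * (r - 1)))))
        (delta (s - 1, r - 1, 1 - t)) else 0)"
  using assms
  by (cases i) (simp_all add: twisted.tensor.act_mult twisted.tensor.act_power act_gen_fun
      twisted.tensor_kpow twisted_kp_delta twisted.e2_power twisted.f2_power twisted.l2_apply
      reg_e_power_delta reg_f_power_delta reg_k_delta regular.powers_scale mult_ac)

text \<open>
  The matrix entry (1,2). Since \<open>e\<close> is lower triangular, \<open>v\<^sub>1\<close> is reached from \<open>v\<^sub>2\<close> only through a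
  factor \<open>f\<close> with no \<open>l\<close> to its right.
\<close>

lemma fst_tensor_second:
  assumes "i \<noteq> P0" "i \<noteq> P5"
  shows "fst (regular.tensor.act (monomial i (r, s, t)) (0, v0))
      = (if i = P1 then fun_scale (vv powi t * beta r) (delta (r - 1, s, t)) else 0)"
  using assms
  by (cases i) (simp_all add: regular.tensor.act_mult regular.tensor.act_power act_gen_fun
      regular.tensor_kpow regular_kp_delta regular.e2_power regular.f2_power regular.l2_apply
      reg_e_power_delta reg_f_power_delta reg_k'_delta regular.powers_scale mult_ac)

text \<open>
  The matrix entry (2,1). Dually, \<open>v\<^sub>2\<close> is reached from \<open>v\<^sub>1\<close> only through a factor \<open>e\<close> with no \<open>l\<close> to
  its left.
\<close>

lemma snd_tensor_first:
  assumes "i \<noteq> P0" "i \<noteq> P5"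
  shows "snd (regular.tensor.act (monomial i (r, s, t)) (v0, 0))
      = (if i = P2 then fun_scale (vv powi (- t) * (vv ^ r * alpha s)) (delta (r, s - 1, t - 1)) else 0)"
  using assms
  by (cases i) (simp_all add: regular.tensor.act_mult regular.tensor.act_power act_gen_fun
      regular.tensor_kpow regular_kp_delta regular.e2_power regular.f2_power regular.l2_apply
      reg_e_power_delta reg_f_power_delta reg_k'_delta regular.powers_scale
      regular.powers_add mult_ac)

text \<open>
  The matrix entry (1,1). In \<open>f\<^sup>r e\<^sup>s\<close> there is a second path from \<open>v\<^sub>1\<close> back to \<open>v\<^sub>1\<close>, by way of \<open>v\<^sub>2\<close>,
  and an \<open>l\<close> between \<open>f\<^sup>r\<close> and \<open>e\<^sup>s\<close> blocks it. This lower term is what tells \<open>\<B>\<^sub>3\<close> from \<open>\<B>\<^sub>4\<close>.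
\<close>

lemma fst_tensor_first:
  "fst (regular.tensor.act (monomial P3 (r, s, t)) (v0, 0))
    = fun_scale (vv powi (- t) * inverse vv ^ r) (delta (r, s, t))
      + fun_scale (vv powi (- t) * (beta r * alpha s)) (delta (r - 1, s - 1, t - 1))"
  "fst (regular.tensor.act (monomial P4 (r, s, t)) (v0, 0))
    = fun_scale (vv powi (- t) * inverse vv ^ r) (delta (r, s, t))"
  by (simp_all add: regular.tensor.act_mult regular.tensor.act_power act_gen_fun
      regular.tensor_kpow regular_kp_delta regular.e2_power regular.f2_power regular.l2_apply
      reg_e_power_delta reg_f_power_delta reg_k'_delta regular.powers_scale
      regular.powers_add mult_ac)

text \<open>
  Index shifts such as \<open>r \<mapsto> r - 1\<close> are injective only away from 0, so injectivity is required only
  where the coefficient is nonzero.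
\<close>

lemma delta_sum_eq_0_imp:
  assumes fin: "finite T" and inj: "inj_on h {p \<in> T. a p \<noteq> 0}"
    and zero: "(\<Sum>p\<in>T. fun_scale (a p) (delta (h p))) = 0" and "p \<in> T"
  shows "a p = 0"
proof (rule ccontr)
  assume "a p \<noteq> 0"
  have app: "(\<Sum>p\<in>T. F p) q = (\<Sum>p\<in>T. F p q)" for F :: "_ \<Rightarrow> U_fun" and q
    by (induction T rule: infinite_finite_induct) simp_all
  have "0 = (\<Sum>p'\<in>T. fun_scale (a p') (delta (h p'))) (h p)"
    using zero by simp
  also have "\<dots> = (\<Sum>p'\<in>T. if p' = p then a p else 0)"
    unfolding app
    by (rule sum.cong) (use inj \<open>a p \<noteq> 0\<close> \<open>p \<in> T\<close> in \<open>auto simp: fun_scale_def delta_def inj_on_def\<close>)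
  also have "\<dots> = a p" using fin \<open>p \<in> T\<close> by simp
  finally show False using \<open>a p \<noteq> 0\<close> by simp
qed

lemma UNIV_piece: "(UNIV :: piece set) = {P0, P1, P2, P3, P4, P5}"
  using piece.exhaust by auto

lemma sum_UNIV_piece: "(\<Sum>i\<in>UNIV. F i) = F P0 + (F P1 + (F P2 + (F P3 + (F P4 + F P5))))"
  by (simp add: UNIV_piece)

section \<open>Linear independence of the monomials\<close>

lemma alpha_eq_0_iff: "alpha n = 0 \<longleftrightarrow> n = 0"
  using qn_inverse_vv_nonzero[of n] by auto

text \<open>
  The six coordinates are consulted in an order that isolates the unknown coefficients. Killing \<open>l\<close>
  leaves \<open>\<B>\<^sub>0\<close>; of the other families, the matrix entry (2,2) leaves \<open>\<B>\<^sub>5\<close>; once these are known to vanish,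
  the entry (1,2) leaves \<open>\<B>\<^sub>1\<close> with \<open>r > 0\<close> and the entry (2,1) leaves \<open>\<B>\<^sub>2\<close> with \<open>s > 0\<close>. After
  that the remaining index sets of \<open>\<B>\<^sub>1\<close>, \<open>\<B>\<^sub>2\<close> and \<open>\<B>\<^sub>3 \<union> \<B>\<^sub>4\<close> are disjoint, so \<open>l = 1\<close> makes the
  first two vanish and the last two opposite to each other. In the entry (1,1) the leading terms of
  \<open>\<B>\<^sub>3\<close> and \<open>\<B>\<^sub>4\<close> then cancel, and only the lower term of \<open>\<B>\<^sub>3\<close> survives.
\<close>

lemma monomial_coefficients_vanish:
  assumes fin: "finite T"
    and zero: "(\<Sum>p\<in>T. \<Sum>i\<in>UNIV. MU_scale (C i p) (monomial i p)) = 0"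
    and supp: "\<And>i p. p \<notin> index_set i \<Longrightarrow> C i p = 0"
    and "p \<in> T"
  shows "C i p = 0"
proof -
  have conv: "\<forall>p\<in>T. P p" if "\<And>r s t. (r, s, t) \<in> T \<Longrightarrow> P (r, s, t)" for P
    using that by auto
  note fun_simps = regular.scale_zero_right regular.scale_zero_left regular.scale_scale
  have supp': "C P2 (0, 0, t) = 0"
    "C P3 (0, s, t) = 0" "C P3 (r, 0, t) = 0" "C P4 (0, s, t) = 0" "C P4 (r, 0, t) = 0"
    "C P5 (0, s, t) = 0" "C P5 (r, 0, t) = 0" for r s t
    using supp by auto
  (* Where l acts by 0, only the monomials without l survive. *)
  have C0: "\<forall>p\<in>T. C P0 p = 0"
  proof -
    have "l_zero.act (\<Sum>p\<in>T. \<Sum>i\<in>UNIV. MU_scale (C i p) (monomial i p)) v0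
      = (\<Sum>p\<in>T. fun_scale (C P0 p) (delta p))"
      unfolding l_zero.act_sum
      by (intro sum.cong refl)
        (simp only: split_paired_all sum_UNIV_piece l_zero.act_scale,
         simp add: fun_simps l_zero_monomial
           del: monomial.simps)
    then have 0: "(\<Sum>p\<in>T. fun_scale (C P0 p) (delta p)) = 0"
      by (simp add: zero l_zero.act_zero)
    then show ?thesis
      by (intro ballI) (rule delta_sum_eq_0_imp[OF fin, where h = "\<lambda>p. p"], simp_all)
  qed
  (* From the matrix entry (2,2), in the order with e to the left of f. *)
  have C5: "\<forall>p\<in>T. C P5 p = 0"
  proof -
    define a where "a = (\<lambda>(r, s, t). C P5 (r, s, t) * (vv powi t * (alpha s * (beta r * vv ^ (2 * (r - 1))))))"
    define h where "h = (\<lambda>(r :: nat, s :: nat, t :: int). (s - 1, r - 1, 1 - t))"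
    have "snd (twisted.tensor.act (\<Sum>p\<in>T. \<Sum>i\<in>UNIV. MU_scale (C i p) (monomial i p)) (0, v0))
      = (\<Sum>p\<in>T. fun_scale (a p) (delta (h p)))"
      using C0 unfolding twisted.tensor.act_sum snd_sum
      by (intro sum.cong refl)
        (simp only: split_paired_all sum_UNIV_piece twisted.tensor.act_scale,
         simp add: fun_simps snd_twisted_tensor_second twisted.scale2_simps a_def h_def
           del: monomial.simps)
    then have 0: "(\<Sum>p\<in>T. fun_scale (a p) (delta (h p))) = 0"
      by (simp add: zero twisted.tensor.act_zero)
    have "inj_on h {p \<in> T. a p \<noteq> 0}"
      by (auto simp: inj_on_def h_def a_def alpha_eq_0_iff)
    then have a: "a p = 0" if "p \<in> T" for p
      by (rule delta_sum_eq_0_imp[OF fin _ 0 that])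
    show ?thesis
    proof (rule conv)
      fix r s t assume "(r, s, t) \<in> T"
      from a[OF this] show "C P5 (r, s, t) = 0"
        by (cases "r = 0"; cases "s = 0") (auto simp: a_def supp' alpha_eq_0_iff)
    qed
  qed
  (* From the matrix entry (1,2). *)
  have C1: "\<forall>(r, s, t)\<in>T. r > 0 \<longrightarrow> C P1 (r, s, t) = 0"
  proof -
    define a where "a = (\<lambda>(r, s, t). C P1 (r, s, t) * (vv powi t * beta r))"
    define h where "h = (\<lambda>(r :: nat, s :: nat, t :: int). (r - 1, s, t))"
    have "fst (regular.tensor.act (\<Sum>p\<in>T. \<Sum>i\<in>UNIV. MU_scale (C i p) (monomial i p)) (0, v0))
      = (\<Sum>p\<in>T. fun_scale (a p) (delta (h p)))"
      using C0 C5 unfolding regular.tensor.act_sum fst_sum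
      by (intro sum.cong refl)
        (simp only: split_paired_all sum_UNIV_piece regular.tensor.act_scale,
         simp add: fun_simps fst_tensor_second regular.scale2_simps a_def h_def
           del: monomial.simps)
    then have 0: "(\<Sum>p\<in>T. fun_scale (a p) (delta (h p))) = 0"
      by (simp add: zero regular.tensor.act_zero)
    have "inj_on h {p \<in> T. a p \<noteq> 0}"
      by (auto simp: inj_on_def h_def a_def alpha_eq_0_iff)
    then have a: "a p = 0" if "p \<in> T" for p
      by (rule delta_sum_eq_0_imp[OF fin _ 0 that])
    show ?thesis
    proof (rule conv, clarify)
      fix r s t assume "(r, s, t) \<in> T" "0 < r"
      from a[OF this(1)] show "C P1 (r, s, t) = 0"
        using \<open>0 < r\<close> by (auto simp: a_def alpha_eq_0_iff)
    qed
  qed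
  (* From the matrix entry (2,1). *)
  have C2: "\<forall>(r, s, t)\<in>T. s > 0 \<longrightarrow> C P2 (r, s, t) = 0"
  proof -
    define a where "a = (\<lambda>(r, s, t). C P2 (r, s, t) * (vv powi (- t) * (vv ^ r * alpha s)))"
    define h where "h = (\<lambda>(r :: nat, s :: nat, t :: int). (r, s - 1, t - 1))"
    have "snd (regular.tensor.act (\<Sum>p\<in>T. \<Sum>i\<in>UNIV. MU_scale (C i p) (monomial i p)) (v0, 0))
      = (\<Sum>p\<in>T. fun_scale (a p) (delta (h p)))"
      using C0 C5 unfolding regular.tensor.act_sum snd_sum
      by (intro sum.cong refl)
        (simp only: split_paired_all sum_UNIV_piece regular.tensor.act_scale,
         simp add: fun_simps snd_tensor_first regular.scale2_simps a_def h_def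
           del: monomial.simps)
    then have 0: "(\<Sum>p\<in>T. fun_scale (a p) (delta (h p))) = 0"
      by (simp add: zero regular.tensor.act_zero)
    have "inj_on h {p \<in> T. a p \<noteq> 0}"
      by (auto simp: inj_on_def h_def a_def alpha_eq_0_iff)
    then have a: "a p = 0" if "p \<in> T" for p
      by (rule delta_sum_eq_0_imp[OF fin _ 0 that])
    show ?thesis
    proof (rule conv, clarify)
      fix r s t assume "(r, s, t) \<in> T" "0 < s"
      from a[OF this(1)] show "C P2 (r, s, t) = 0"
        using \<open>0 < s\<close> by (auto simp: a_def alpha_eq_0_iff)
    qed
  qed
  (* Where l acts by 1, the surviving families become indistinguishable. *)
  have C1234: "C P1 p + C P2 p + C P3 p + C P4 p = 0" if "p \<in> T" for p
  proof -
    have "l_one.act (\<Sum>p\<in>T. \<Sum>i\<in>UNIV. MU_scale (C i p) (monomial i p)) v0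
      = (\<Sum>p\<in>T. fun_scale (C P1 p + C P2 p + C P3 p + C P4 p) (delta p))"
      using C0 C5 unfolding l_one.act_sum
      by (intro sum.cong refl)
        (simp only: split_paired_all sum_UNIV_piece l_one.act_scale,
         simp add: fun_simps l_one_monomial regular.scale_left_distrib add.assoc
           del: monomial.simps)
    then have 0: "(\<Sum>p\<in>T. fun_scale (C P1 p + C P2 p + C P3 p + C P4 p) (delta p)) = 0"
      by (simp add: zero l_one.act_zero)
    from delta_sum_eq_0_imp[OF fin _ this that] show ?thesis by simp
  qed
  have C1': "\<forall>p\<in>T. C P1 p = 0"
  proof (rule conv)
    fix r s t assume "(r, s, t) \<in> T"
    then show "C P1 (r, s, t) = 0"
      using C1 C2 C1234[of "(r, s, t)"] supp'
      by (cases "r = 0"; cases "s = 0") auto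
  qed
  have C2': "\<forall>p\<in>T. C P2 p = 0"
  proof (rule conv)
    fix r s t assume "(r, s, t) \<in> T"
    then show "C P2 (r, s, t) = 0"
      using C1' C2 C1234[of "(r, s, t)"] supp'
      by (cases "s = 0") auto
  qed
  have C34: "\<forall>p\<in>T. C P4 p = - C P3 p"
    using C1234 C1' C2' by (simp add: eq_neg_iff_add_eq_0 add.commute)
  (* From the matrix entry (1,1). *)
  have C3: "\<forall>p\<in>T. C P3 p = 0"
  proof -
    define a where "a = (\<lambda>(r, s, t). C P3 (r, s, t) * (vv powi (- t) * (beta r * alpha s)))"
    define h where "h = (\<lambda>(r :: nat, s :: nat, t :: int). (r - 1, s - 1, t - 1))"
    have "fst (regular.tensor.act (\<Sum>p\<in>T. \<Sum>i\<in>UNIV. MU_scale (C i p) (monomial i p)) (v0, 0))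
      = (\<Sum>p\<in>T. fun_scale (a p) (delta (h p)))"
      using C0 C1' C2' C34 C5 unfolding regular.tensor.act_sum fst_sum
      by (intro sum.cong refl)
        (simp only: split_paired_all sum_UNIV_piece regular.tensor.act_scale,
         simp add: fun_simps fst_tensor_first regular.scale2_simps
           regular.scale_right_distrib regular.scale_minus_left a_def h_def
           del: monomial.simps)
    then have 0: "(\<Sum>p\<in>T. fun_scale (a p) (delta (h p))) = 0"
      by (simp add: zero regular.tensor.act_zero)
    have "inj_on h {p \<in> T. a p \<noteq> 0}"
      by (auto simp: inj_on_def h_def a_def alpha_eq_0_iff)
    then have a: "a p = 0" if "p \<in> T" for p
      by (rule delta_sum_eq_0_imp[OF fin _ 0 that])
    show ?thesis
    proof (rule conv)
      fix r s t assume "(r, s, t) \<in> T"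
      from a[OF this] show "C P3 (r, s, t) = 0"
        by (cases "r = 0"; cases "s = 0") (auto simp: a_def supp' alpha_eq_0_iff)
    qed
  qed
  show ?thesis
    using C0 C1' C2' C3 C34 C5 \<open>p \<in> T\<close> by (cases i) auto
qed

text \<open>
  Stated for families rather than for sets of elements, so that it yields at once that the monomials
  are pairwise distinct and that they are independent.
\<close>

lemma monomial_relation_trivial:
  assumes fin: "finite J" and J: "J \<subseteq> (SIGMA i:UNIV. index_set i)"
    and zero: "(\<Sum>(i, p)\<in>J. MU_scale (c (i, p)) (monomial i p)) = 0" and "j \<in> J"
  shows "c j = 0"
proof -
  have finite_piece: "finite (UNIV :: piece set)"
    by (simp add: UNIV_piece)
  define C where "C = (\<lambda>i p. if (i, p) \<in> J then c (i, p) else 0)"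
  have "(\<Sum>p\<in>snd ` J. \<Sum>i\<in>UNIV. MU_scale (C i p) (monomial i p))
      = (\<Sum>(i, p)\<in>UNIV \<times> snd ` J. MU_scale (C i p) (monomial i p))"
    by (subst sum.swap) (simp add: sum.cartesian_product)
  also have "\<dots> = (\<Sum>(i, p)\<in>J. MU_scale (c (i, p)) (monomial i p))"
    by (rule sum.mono_neutral_cong_right)
      (use fin finite_piece in \<open>auto simp: C_def split: if_splits intro!: rev_image_eqI\<close>)
  finally have "(\<Sum>p\<in>snd ` J. \<Sum>i\<in>UNIV. MU_scale (C i p) (monomial i p)) = 0"
    using zero by simp
  moreover have "C i p = 0" if "p \<notin> index_set i" for i p
    using that J by (auto simp: C_def)
  ultimately have "C (fst j) (snd j) = 0"
    using monomial_coefficients_vanish[of "snd ` J" C "snd j" "fst j"] fin \<open>j \<in> J\<close> by simp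
  then show ?thesis
    using \<open>j \<in> J\<close> by (simp add: C_def)
qed

lemma inj_on_monomial: "inj_on (\<lambda>(i, p). monomial i p) (SIGMA i:UNIV. index_set i)"
proof (rule inj_onI)
  fix x y assume xy: "x \<in> (SIGMA i:UNIV. index_set i)" "y \<in> (SIGMA i:UNIV. index_set i)"
    and eq: "(\<lambda>(i, p). monomial i p) x = (\<lambda>(i, p). monomial i p) y"
  show "x = y"
  proof (rule ccontr)
    assume "x \<noteq> y"
    define c :: "_ \<Rightarrow> Cv" where "c = (\<lambda>j. if j = x then 1 else - 1)"
    have "(\<Sum>(i, p)\<in>{x, y}. MU_scale (c (i, p)) (monomial i p)) = 0"
      using \<open>x \<noteq> y\<close> eq by (simp add: case_prod_beta c_def)
    then have "c x = 0"
      using monomial_relation_trivial[of "{x, y}" c x] xy by simp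
    then show False by (simp add: c_def)
  qed
qed

lemma independent_monomials: "MU.independent (\<Union>i. MU_B i)"
proof -
  have B: "(\<Union>i. MU_B i) = (\<lambda>(i, p). monomial i p) ` (SIGMA i:UNIV. index_set i)"
    by (force simp: MU_B_def)
  show ?thesis
    unfolding B MU.independent_explicit_module
  proof (intro allI impI)
    fix T u x
    assume T: "finite T" "T \<subseteq> (\<lambda>(i, p). monomial i p) ` (SIGMA i:UNIV. index_set i)"
      and zero: "(\<Sum>x\<in>T. MU_scale (u x) x) = 0" and "x \<in> T"
    obtain J where J: "J \<subseteq> (SIGMA i:UNIV. index_set i)" "finite J" "T = (\<lambda>(i, p). monomial i p) ` J"
      using finite_subset_image[OF T] by blast
    have "(\<Sum>(i, p)\<in>J. MU_scale (u (monomial i p)) (monomial i p)) = (\<Sum>x\<in>T. MU_scale (u x) x)"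
      unfolding J(3) by (subst sum.reindex)
        (use inj_on_subset[OF inj_on_monomial J(1)] in \<open>auto simp: case_prod_beta\<close>)
    with zero have "(\<Sum>(i, p)\<in>J. MU_scale ((\<lambda>(i, p). u (monomial i p)) (i, p)) (monomial i p)) = 0"
      by simp
    note 0 = monomial_relation_trivial[OF J(2,1) this]
    obtain j where "j \<in> J" "x = (\<lambda>(i, p). monomial i p) j"
      using \<open>x \<in> T\<close> J(3) by blast
    then show "u x = 0"
      using 0[of j] by (simp add: case_prod_beta)
  qed
qed

section \<open>Reordering words\<close>

lemma span_image_closed:
  assumes x: "x \<in> MU.span B"
    and lin: "\<And>x y. g (x + y) = g x + g y" "\<And>c x. g (MU_scale c x) = MU_scale c (g x)" "g 0 = 0"
    and B: "\<And>b. b \<in> B \<Longrightarrow> g b \<in> MU.span C"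
  shows "g x \<in> MU.span C"
  using x
proof (induction rule: MU.span_induct)
  case base
  then show ?case
    by (simp add: MU.subspace_def lin MU.span_zero MU.span_add MU.span_scale)
next
  case (step x)
  then show ?case by (rule B)
qed

lemma span_mult_right:
  assumes "x \<in> MU.span B" "\<And>b. b \<in> B \<Longrightarrow> b * a \<in> MU.span C"
  shows "x * a \<in> MU.span C"
  by (rule span_image_closed[OF assms(1)]) (simp_all add: distrib_right MU_scale_mult_left assms(2))

lemma span_subsetI: "(\<And>b. b \<in> B \<Longrightarrow> b \<in> MU.span C) \<Longrightarrow> MU.span B \<subseteq> MU.span C"
  by (simp add: MU.span_minimal subsetI)

definition weight :: "Cv \<Rightarrow> MU \<Rightarrow> bool" where
  "weight c x \<longleftrightarrow> c \<noteq> 0 \<and> kk * x = MU_scale c (x * kk)"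

lemma weight_one: "weight 1 1"
  by (simp add: weight_def)

lemma weight_mult: "weight c x \<Longrightarrow> weight d y \<Longrightarrow> weight (c * d) (x * y)"
  by (simp add: weight_def MU_scale_mult_left MU_scale_mult_right mult.assoc)
    (metis MU_scale_mult_left MU_scale_mult_right MU.scale_scale mult.assoc)

lemma weight_power: "weight c x \<Longrightarrow> weight (c ^ n) (x ^ n)"
  by (induction n) (simp_all add: weight_one weight_mult)

definition homogeneous :: "MU \<Rightarrow> bool" where
  "homogeneous x \<longleftrightarrow> (\<exists>c. weight c x)"

lemma homogeneous_mult: "homogeneous x \<Longrightarrow> homogeneous y \<Longrightarrow> homogeneous (x * y)"
  unfolding homogeneous_def using weight_mult by blast

lemma homogeneous_power: "homogeneous x \<Longrightarrow> homogeneous (x ^ n)"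
  unfolding homogeneous_def using weight_power by blast

lemma kk_kkinv: "kk * kkinv = 1" "kkinv * kk = 1" "kk * (kkinv * x) = x" "kkinv * (kk * x) = x"
  using MU_gen_relations(1,2) by (simp_all flip: mult.assoc)

lemma weight_of_conjugate: "c \<noteq> 0 \<Longrightarrow> kk * x * kkinv = MU_scale c x \<Longrightarrow> weight c x"
  unfolding weight_def by (metis MU_scale_mult_left kk_kkinv(2) mult.assoc mult_1_right)

lemma weight_ll: "weight 1 ll"
  by (simp add: weight_def MU_gen_relations)

lemma homogeneous_ll: "homogeneous ll"
  using weight_ll by (auto simp: homogeneous_def)

lemma kkinv_weight: "weight c x \<Longrightarrow> kkinv * x = MU_scale (inverse c) (x * kkinv)"
proof -
  assume w: "weight c x"
  have "MU_scale c (kkinv * x) = kkinv * MU_scale c (x * kk) * kkinv"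
    by (simp add: MU_scale_mult_left MU_scale_mult_right mult.assoc kk_kkinv)
  also have "\<dots> = x * kkinv"
    using w by (metis weight_def kk_kkinv(4) mult.assoc)
  finally have "MU_scale (inverse c) (MU_scale c (kkinv * x)) = MU_scale (inverse c) (x * kkinv)"
    by simp
  then show ?thesis using w by (simp add: weight_def)
qed

lemma kpow_0 [simp]: "kpow 0 = 1"
  by (simp add: kpow_def)

lemma kpow_minus: "kpow (- int n) = kkinv ^ n"
  by (simp add: kpow_def)

lemma kpow_kk: "kpow t * kk = kpow (t + 1)"
proof -
  consider n where "t = int n" | n where "t = - int (Suc n)"
    by (metis nonneg_int_cases negD not_le_imp_less)
  then show ?thesis
  proof cases
    case 1
    then show ?thesis by (simp add: kpow_def nat_add_distrib power_commutes)
  next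
    case (2 n)
    then have "kpow t = kkinv ^ Suc n" "kpow (t + 1) = kkinv ^ n"
      using kpow_minus[of "Suc n"] kpow_minus[of n] by simp_all
    then show ?thesis
      by (metis kk_kkinv(2) mult.assoc mult.right_neutral power_Suc2)
  qed
qed

lemma kpow_kkinv: "kpow t * kkinv = kpow (t - 1)"
  using kpow_kk[of "t - 1"] by (metis diff_add_cancel kk_kkinv(1) mult.assoc mult_1_right)

lemma kpow_ll: "kpow t * ll = ll * kpow t"
proof -
  have "kk ^ n * ll = ll * kk ^ n" "kkinv ^ n * ll = ll * kkinv ^ n" for n
    using kkinv_weight[OF weight_ll]
    by (induction n) (simp_all add: MU_gen_relations mult.assoc, simp_all add: MU_gen_relations flip: mult.assoc)
  then show ?thesis by (simp add: kpow_def)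
qed


text \<open>
  Since \<open>k\<close> commutes with every word up to a scalar, its powers can be kept on the far right. Spans of
  families of the form \<open>x k\<^sup>t\<close> then reduce all closure properties to words without \<open>k\<close>.
\<close>

definition kspan :: "MU set \<Rightarrow> MU set" where
  "kspan X = MU.span {x * kpow t | x t. x \<in> X}"

lemma kspan_base_kpow: "x \<in> X \<Longrightarrow> x * kpow t \<in> kspan X"
  unfolding kspan_def by (rule MU.span_base) blast

lemma kspan_base: "x \<in> X \<Longrightarrow> x \<in> kspan X"
  using kspan_base_kpow[of x X 0] by simp

lemma kspan_closed:
  "0 \<in> kspan X"
  "x \<in> kspan X \<Longrightarrow> y \<in> kspan X \<Longrightarrow> x + y \<in> kspan X"
  "x \<in> kspan X \<Longrightarrow> y \<in> kspan X \<Longrightarrow> x - y \<in> kspan X"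
  "x \<in> kspan X \<Longrightarrow> MU_scale c x \<in> kspan X"
  unfolding kspan_def by (simp_all add: MU.span_zero MU.span_add MU.span_diff MU.span_scale)

lemma span_subset_kspan: "B \<subseteq> kspan X \<Longrightarrow> MU.span B \<subseteq> kspan X"
  unfolding kspan_def by (simp add: MU.span_minimal)

lemma kpow_add: "kpow s * kpow t = kpow (s + t)"
proof (induction t rule: int_induct[where k = 0])
  case (step1 t)
  then show ?case by (metis add.assoc kpow_kk mult.assoc)
next
  case (step2 t)
  then show ?case by (metis add_diff_eq kpow_kkinv mult.assoc)
qed simp

lemma kspan_mult_kpow: "x \<in> kspan X \<Longrightarrow> x * kpow t \<in> kspan X"
  unfolding kspan_def
proof (erule span_mult_right, clarify)
  fix x s assume "x \<in> X"
  then have "x * kpow (s + t) \<in> MU.span {x * kpow t |x t. x \<in> X}"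
    by (blast intro: MU.span_base)
  then show "x * kpow s * kpow t \<in> MU.span {x * kpow t |x t. x \<in> X}"
    by (simp only: mult.assoc kpow_add)
qed

lemma kspan_mult:
  assumes y: "y \<in> kspan X" and X: "\<And>x. x \<in> X \<Longrightarrow> a * x * b \<in> kspan Y"
    and b: "\<And>t. kpow t * b = b * kpow t"
  shows "a * y * b \<in> kspan Y"
  using y unfolding kspan_def
proof (rule span_image_closed)
  fix z assume "z \<in> {x * kpow t |x t. x \<in> X}"
  then obtain x t where z: "z = x * kpow t" "x \<in> X" by blast
  have "a * z * b = a * x * b * kpow t"
    by (simp add: z mult.assoc b)
  also have "\<dots> \<in> kspan Y"
    using X[OF z(2)] by (rule kspan_mult_kpow)
  finally show "a * z * b \<in> MU.span {x * kpow t |x t. x \<in> Y}"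
    by (simp add: kspan_def)
qed (simp_all add: distrib_left distrib_right MU_scale_mult_left MU_scale_mult_right)

lemma kspan_mult_left:
  assumes "y \<in> kspan X" "\<And>x. x \<in> X \<Longrightarrow> a * x \<in> kspan Y"
  shows "a * y \<in> kspan Y"
  using kspan_mult[of y X a 1 Y] assms by simp

lemma kspan_mult_ll:
  assumes "y \<in> kspan X" "\<And>x. x \<in> X \<Longrightarrow> x * ll \<in> kspan Y"
  shows "y * ll \<in> kspan Y"
  using kspan_mult[of y X 1 ll Y] assms by (simp add: kpow_ll)

lemma kspan_mono: "X \<subseteq> kspan Y \<Longrightarrow> x \<in> kspan X \<Longrightarrow> x \<in> kspan Y"
  using kspan_mult_left[of x X 1 Y] by auto

lemma kspan_kk:
  assumes X: "\<And>x. x \<in> X \<Longrightarrow> homogeneous x" and y: "y \<in> kspan X"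
  shows "kk * y \<in> kspan X" "kkinv * y \<in> kspan X"
proof -
  have *: "kk * x \<in> kspan X \<and> kkinv * x \<in> kspan X" if x: "x \<in> X" for x
  proof -
    obtain c where c: "weight c x" using X[OF x] by (auto simp: homogeneous_def)
    have "kk * x = MU_scale c (x * kpow 1)" "kkinv * x = MU_scale (inverse c) (x * kpow (- 1))"
      using c kkinv_weight[OF c] by (simp_all add: weight_def kpow_def)
    then show ?thesis
      using x by (simp add: kspan_closed kspan_base_kpow)
  qed
  show "kk * y \<in> kspan X" "kkinv * y \<in> kspan X"
    using y * by (blast intro: kspan_mult_left)+
qed

text \<open>
  The quadratic relation says precisely that \<open>z = ql - lq\<close> satisfies \<open>qz = u\<^sup>-\<^sup>2 zq\<close>. Expanding
  \<open>q\<^bsup>n+1\<^esup>l - lq\<^bsup>n+1\<^esup> = \<Sum> q\<^sup>i z q\<^bsup>n-i\<^esup>\<close> and moving \<open>z\<close> to the left gives a quantum integer.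
\<close>

lemma ll_commutator_power:
  assumes u: "u \<noteq> 0"
    and rel: "MU_scale (u + inverse u) (q * ll * q) = MU_scale u (q * q * ll) + MU_scale (inverse u) (ll * (q * q))"
  shows "q ^ Suc n * ll - ll * q ^ Suc n = MU_scale (qn (inverse (u\<^sup>2)) (Suc n)) ((q * ll - ll * q) * q ^ n)"
proof (induction n)
  case 0
  then show ?case by (simp add: qn_Suc)
next
  case (Suc n)
  define z where "z = q * ll - ll * q"
  have "MU_scale u (q * z) = MU_scale (inverse u) (z * q)"
    using rel by (simp add: z_def algebra_simps MU.scale_left_distrib MU.scale_right_diff_distrib)
  then have "MU_scale (inverse u) (MU_scale u (q * z)) = MU_scale (inverse u) (MU_scale (inverse u) (z * q))"
    by simp
  then have qz: "q * z = MU_scale (inverse (u\<^sup>2)) (z * q)"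
    using u by (simp add: power2_eq_square)
  have "q ^ Suc (Suc n) * ll - ll * q ^ Suc (Suc n) = q * (q ^ Suc n * ll - ll * q ^ Suc n) + z * q ^ Suc n"
    by (simp add: z_def algebra_simps)
  also have "q * (q ^ Suc n * ll - ll * q ^ Suc n)
      = MU_scale (qn (inverse (u\<^sup>2)) (Suc n)) (q * z * q ^ n)"
    unfolding Suc by (simp add: z_def MU_scale_mult_right mult.assoc)
  also have "q * z * q ^ n = MU_scale (inverse (u\<^sup>2)) (z * q ^ Suc n)"
    by (simp add: qz MU_scale_mult_left mult.assoc)
  finally show ?case
    by (simp add: qn_Suc'[of _ "Suc n"] z_def[symmetric] MU.scale_left_distrib add.commute mult.commute del: power_Suc)
qed

text \<open>
  Solving for \<open>z q\<^sup>n\<close> eliminates an \<open>l\<close> from between two powers of \<open>q\<close>. This is the only place in the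
  spanning argument that needs a quantum integer to be nonzero.
\<close>

lemma ll_between_powers:
  assumes "u \<noteq> 0" "qn (inverse (u\<^sup>2)) (Suc n) \<noteq> 0"
    and "MU_scale (u + inverse u) (q * ll * q) = MU_scale u (q * q * ll) + MU_scale (inverse u) (ll * (q * q))"
  shows "q * ll * q ^ n \<in> MU.span {q ^ Suc n * ll, ll * q ^ Suc n}"
proof -
  define c where "c = inverse (qn (inverse (u\<^sup>2)) (Suc n))"
  have "MU_scale c (q ^ Suc n * ll - ll * q ^ Suc n) = (q * ll - ll * q) * q ^ n"
    unfolding ll_commutator_power[OF assms(1,3)] using assms(2) by (simp add: c_def)
  then have "q * ll * q ^ n = ll * q ^ Suc n + MU_scale c (q ^ Suc n * ll - ll * q ^ Suc n)"
    by (simp add: algebra_simps)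
  also have "\<dots> \<in> MU.span {q ^ Suc n * ll, ll * q ^ Suc n}"
    by (intro MU.span_add MU.span_scale MU.span_diff MU.span_base insertI1 insertI2)
  finally show ?thesis .
qed

text \<open>
  The pairs \<open>(e, f)\<close> and \<open>(f, e)\<close> enter the spanning argument in the same way. What an argument for
  one of them uses is that \<open>p\<close> passes \<open>q\<close> at the cost of terms in \<open>k\<^sup>\<plusminus>\<^sup>1\<close>, and that \<open>q\<close> passes \<open>l\<close>
  when powers of \<open>q\<close> follow.
\<close>

locale opposite_pair =
  fixes p q :: MU and a b d :: Cv
  assumes weight_p: "weight a p" and weight_q: "weight b q"
    and commutator: "p * q = q * p + MU_scale d (kk - kkinv)"
    and q_ll_power: "q * ll * q ^ n \<in> MU.span {q ^ Suc n * ll, ll * q ^ Suc n}"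
begin

abbreviation ordered :: "MU set" where
  "ordered \<equiv> {q ^ r * p ^ s | r s. True}"

lemma homogeneous_p: "homogeneous p" and homogeneous_q: "homogeneous q"
  using weight_p weight_q by (auto simp: homogeneous_def)

lemmas homogeneous_intros =
  homogeneous_mult homogeneous_power homogeneous_p homogeneous_q homogeneous_ll

lemma homogeneous_ordered: "x \<in> ordered \<Longrightarrow> homogeneous x"
  by (clarify; intro homogeneous_intros)

lemma q_mult_ordered: "y \<in> kspan ordered \<Longrightarrow> q * y \<in> kspan ordered"
proof (erule kspan_mult_left)
  fix x assume "x \<in> ordered"
  then obtain r s where "x = q ^ r * p ^ s" by blast
  then have "q * x = q ^ Suc r * p ^ s" by (simp add: mult.assoc)
  then show "q * x \<in> kspan ordered" by (blast intro: kspan_base)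
qed

lemma p_mult_ordered: "y \<in> kspan ordered \<Longrightarrow> p * y \<in> kspan ordered"
proof (erule kspan_mult_left)
  have "p * (q ^ r * p ^ s) \<in> kspan ordered" for r s
  proof (induction r)
    case 0
    have "p * (q ^ 0 * p ^ s) = q ^ 0 * p ^ Suc s" by simp
    then show ?case by (blast intro: kspan_base)
  next
    case (Suc r)
    define y where "y = q ^ r * p ^ s"
    have y: "y \<in> kspan ordered" unfolding y_def by (blast intro: kspan_base)
    have "p * (q ^ Suc r * p ^ s) = p * q * y"
      by (simp add: y_def mult.assoc)
    also have "\<dots> = q * (p * y) + MU_scale d (kk * y - kkinv * y)"
      by (simp add: commutator distrib_right left_diff_distrib MU_scale_mult_left mult.assoc)
    also have "\<dots> \<in> kspan ordered"
      using Suc y by (intro kspan_closed q_mult_ordered kspan_kk homogeneous_ordered) (simp_all add: y_def)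
    finally show ?case .
  qed
  then show "\<And>x. x \<in> ordered \<Longrightarrow> p * x \<in> kspan ordered" by blast
qed

lemma opposite_in_ordered: "p ^ s * q ^ r \<in> kspan ordered"
proof (induction s)
  case 0
  have "p ^ 0 * q ^ r = q ^ r * p ^ 0" by simp
  then show ?case by (blast intro: kspan_base)
next
  case (Suc s)
  then show ?case using p_mult_ordered by (simp add: mult.assoc)
qed

text \<open>
  The words \<open>p\<^sup>s l q\<^sup>r\<close> need not be stable under \<open>q\<close>: moving \<open>q\<close> to \<open>l\<close> produces, besides words of the
  same kind, words that end in \<open>l\<close>. Adding these makes the span stable under \<open>p\<close> and \<open>k\<close>, which is
  what the induction on \<open>s\<close> in \<open>q_mult_p_ll_q\<close> requires.
\<close>

abbreviation ll_ordered :: "MU set" where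
  "ll_ordered \<equiv> {p ^ s * ll * q ^ r | r s. True} \<union> {q ^ r * p ^ s * ll | r s. True}"

lemma homogeneous_ll_ordered: "x \<in> ll_ordered \<Longrightarrow> homogeneous x"
  by (elim UnE; clarify; intro homogeneous_intros)

lemma p_mult_ll_ordered: "y \<in> kspan ll_ordered \<Longrightarrow> p * y \<in> kspan ll_ordered"
proof (erule kspan_mult_left)
  fix x assume "x \<in> ll_ordered"
  then consider r s where "x = p ^ s * ll * q ^ r" | r s where "x = q ^ r * p ^ s * ll" by blast
  then show "p * x \<in> kspan ll_ordered"
  proof cases
    case 1
    then have "p * x = p ^ Suc s * ll * q ^ r" by (simp add: mult.assoc)
    then show ?thesis by (blast intro: kspan_base)
  next
    case 2
    have "p * (q ^ r * p ^ s) * ll \<in> kspan ll_ordered"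
    proof (rule kspan_mult_ll)
      show "p * (q ^ r * p ^ s) \<in> kspan ordered"
        by (rule p_mult_ordered) (blast intro: kspan_base)
    qed (blast intro: kspan_base)
    then show ?thesis by (simp add: 2 mult.assoc)
  qed
qed

lemma q_mult_p_ll_q: "q * (p ^ s * ll * q ^ r) \<in> kspan ll_ordered"
proof (induction s)
  case 0
  have "{q ^ Suc r * ll, ll * q ^ Suc r} \<subseteq> kspan ll_ordered"
  proof -
    have "q ^ Suc r * ll = q ^ Suc r * p ^ 0 * ll" "ll * q ^ Suc r = p ^ 0 * ll * q ^ Suc r"
      by simp_all
    then show ?thesis by (blast intro: kspan_base)
  qed
  then have "q * ll * q ^ r \<in> kspan ll_ordered"
    using q_ll_power span_subset_kspan by blast
  moreover have "q * (p ^ 0 * ll * q ^ r) = q * ll * q ^ r"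
    by (simp add: mult.assoc)
  ultimately show ?case by (simp only:)
next
  case (Suc s)
  define y where "y = p ^ s * ll * q ^ r"
  have y: "y \<in> kspan ll_ordered" unfolding y_def by (blast intro: kspan_base)
  have "q * (p ^ Suc s * ll * q ^ r) = q * p * y"
    by (simp add: y_def mult.assoc)
  also have "q * p = p * q - MU_scale d (kk - kkinv)"
    by (simp add: commutator)
  also have "\<dots> * y = p * (q * y) - MU_scale d (kk * y - kkinv * y)"
    by (simp add: left_diff_distrib MU_scale_mult_left mult.assoc)
  also have "\<dots> \<in> kspan ll_ordered"
    using Suc y
    by (intro kspan_closed p_mult_ll_ordered kspan_kk homogeneous_ll_ordered) (simp_all add: y_def)
  finally show ?case .
qed

end

interpretation E: opposite_pair ee ff "vv\<^sup>2" "inverse (vv\<^sup>2)" "1 / (vv - inverse vv)"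
proof
  show "weight (vv\<^sup>2) ee" "weight (inverse (vv\<^sup>2)) ff"
    by (rule weight_of_conjugate, simp, simp only: MU_gen_relations(3,4))+
  show "ee * ff = ff * ee + MU_scale (1 / (vv - inverse vv)) (kk - kkinv)"
    by (simp only: MU_gen_relations(5)[symmetric]) simp
  show "ff * ll * ff ^ n \<in> MU.span {ff ^ Suc n * ll, ll * ff ^ Suc n}" for n
  proof (rule ll_between_powers)
    show "MU_scale (vv + inverse vv) (ff * ll * ff)
        = MU_scale vv (ff * ff * ll) + MU_scale (inverse vv) (ll * (ff * ff))"
      by (simp only: MU_gen_relations(11) add.commute flip: qtwo_def)
  qed (simp, rule qn_inverse_vv_nonzero, simp)
qed

interpretation F: opposite_pair ff ee "inverse (vv\<^sup>2)" "vv\<^sup>2" "- (1 / (vv - inverse vv))"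
proof
  show "weight (inverse (vv\<^sup>2)) ff" "weight (vv\<^sup>2) ee" by (fact E.weight_q E.weight_p)+
  show "ff * ee = ee * ff + MU_scale (- (1 / (vv - inverse vv))) (kk - kkinv)"
    by (simp add: E.commutator MU.scale_minus_left)
  show "ee * ll * ee ^ n \<in> MU.span {ee ^ Suc n * ll, ll * ee ^ Suc n}" for n
  proof (rule ll_between_powers)
    show "MU_scale (inverse vv + inverse (inverse vv)) (ee * ll * ee)
        = MU_scale (inverse vv) (ee * ee * ll) + MU_scale (inverse (inverse vv)) (ll * (ee * ee))"
      using MU_gen_relations(10) by (simp only: qtwo_def inverse_inverse_eq add.commute[of "inverse vv"])
    show "qn (inverse ((inverse vv)\<^sup>2)) (Suc n) \<noteq> 0"
      unfolding power_inverse inverse_inverse_eq by (rule qn_vv_nonzero) simp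
  qed simp
qed

lemma ll_ff_power_ll: "ll * ff ^ n * ll = ff ^ n * ll"
proof (induction n)
  case (Suc n)
  have "ll * ff ^ Suc n * ll = ll * ff ^ n * (ff * ll)"
    by (simp only: power_Suc2 mult.assoc)
  also have "\<dots> = ll * ff ^ n * ll * ff * ll"
    using MU_gen_relations(9) by (metis mult.assoc)
  also have "\<dots> = ff ^ n * (ll * ff * ll)"
    using Suc by (simp add: mult.assoc)
  also have "\<dots> = ff ^ Suc n * ll"
    by (metis MU_gen_relations(9) power_Suc2 mult.assoc)
  finally show ?case .
qed (simp add: MU_gen_relations)

lemma ll_ee_power_ll: "ll * ee ^ n * ll = ll * ee ^ n"
proof (induction n)
  case (Suc n)
  have "ll * ee ^ Suc n * ll = ll * ee * ee ^ n * ll"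
    by (simp add: mult.assoc)
  also have "\<dots> = ll * ee * (ll * ee ^ n * ll)"
    using MU_gen_relations(8) by (metis mult.assoc)
  also have "\<dots> = ll * ee ^ Suc n"
    unfolding Suc using MU_gen_relations(8) by (metis mult.assoc power_Suc)
  finally show ?case .
qed (simp add: MU_gen_relations)


section \<open>The monomials span\<close>

text \<open>
  The words of the six families with all exponents \<open>r, s \<ge> 0\<close> allowed. The additional words
  coincide with words of other families, and the redundancy avoids case distinctions in the closure
  proofs.
\<close>

definition spanning_words :: "MU set" where
  "spanning_words =
     {ff ^ r * ee ^ s | r s. True} \<union> {ll * ff ^ r * ee ^ s | r s. True}
     \<union> {ff ^ r * ee ^ s * ll | r s. True} \<union> {ll * ff ^ r * ee ^ s * ll | r s. True}
     \<union> {ff ^ r * ll * ee ^ s | r s. True} \<union> {ee ^ s * ll * ff ^ r | r s. True}"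

lemma spanning_words_intros:
  "ff ^ r * ee ^ s \<in> spanning_words"
  "ll * ff ^ r * ee ^ s \<in> spanning_words"
  "ff ^ r * ee ^ s * ll \<in> spanning_words"
  "ll * ff ^ r * ee ^ s * ll \<in> spanning_words"
  "ff ^ r * ll * ee ^ s \<in> spanning_words"
  "ee ^ s * ll * ff ^ r \<in> spanning_words"
  unfolding spanning_words_def by blast+

lemma spanning_words_cases:
  assumes "x \<in> spanning_words"
  obtains r s where "x = ff ^ r * ee ^ s" | r s where "x = ll * ff ^ r * ee ^ s"
    | r s where "x = ff ^ r * ee ^ s * ll" | r s where "x = ll * ff ^ r * ee ^ s * ll"
    | r s where "x = ff ^ r * ll * ee ^ s" | r s where "x = ee ^ s * ll * ff ^ r"
  using assms unfolding spanning_words_def by blast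

lemmas in_words = spanning_words_intros[THEN kspan_base]

lemma homogeneous_spanning_words: "x \<in> spanning_words \<Longrightarrow> homogeneous x"
  unfolding spanning_words_def by (elim UnE; clarify; intro E.homogeneous_intros)

lemma ordered_subsets:
  assumes "u \<in> kspan E.ordered"
  shows "u \<in> kspan spanning_words" "ll * u \<in> kspan spanning_words"
    "u * ll \<in> kspan spanning_words" "ll * u * ll \<in> kspan spanning_words"
proof -
  show "u \<in> kspan spanning_words"
    by (rule kspan_mono[OF _ assms]) (auto intro: in_words)
  show "ll * u \<in> kspan spanning_words"
    by (rule kspan_mult_left[OF assms]) (auto simp: in_words simp flip: mult.assoc)
  show "u * ll \<in> kspan spanning_words"
    by (rule kspan_mult_ll[OF assms]) (auto intro: in_words)
  show "ll * u * ll \<in> kspan spanning_words"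
    by (rule kspan_mult[OF assms _ kpow_ll]) (auto simp: in_words simp flip: mult.assoc)
qed

lemma ee_ff_in_ordered: "ee ^ s * ff ^ r \<in> kspan E.ordered"
  by (rule E.opposite_in_ordered)

lemma ff_ee_in_opposite: "ff ^ r * ee ^ s \<in> kspan F.ordered"
  by (rule F.opposite_in_ordered)

lemma ff_ee_in_ordered: "ff ^ r * ee ^ s \<in> kspan E.ordered"
  by (blast intro: kspan_base)

lemma E_ll_ordered_subset: "y \<in> kspan E.ll_ordered \<Longrightarrow> y \<in> kspan spanning_words"
  by (erule kspan_mono[rotated]) (auto intro: in_words)

lemma F_ll_ordered_subset: "y \<in> kspan F.ll_ordered \<Longrightarrow> y \<in> kspan spanning_words"
  by (erule kspan_mono[rotated]) (auto intro: in_words ordered_subsets(3) ee_ff_in_ordered)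

lemma ll_mult_words:
  assumes "x \<in> spanning_words"
  shows "ll * x \<in> kspan spanning_words"
  using assms
proof (cases rule: spanning_words_cases)
  case (1 r s)
  then show ?thesis using in_words(2)[of r s] by (simp add: mult.assoc)
next
  case (2 r s)
  then have "ll * x = ll * ff ^ r * ee ^ s"
    using MU_gen_relations(6) by (metis mult.assoc)
  then show ?thesis using in_words(2)[of r s] by simp
next
  case (3 r s)
  then show ?thesis using in_words(4)[of r s] by (simp add: mult.assoc)
next
  case (4 r s)
  then have "ll * x = ll * ff ^ r * ee ^ s * ll"
    using MU_gen_relations(6) by (metis mult.assoc)
  then show ?thesis using in_words(4)[of r s] by simp
next
  case (5 r s)
  then have "ll * x = ff ^ r * ll * ee ^ s"
    using ll_ff_power_ll by (metis mult.assoc)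
  then show ?thesis using in_words(5)[of r s] by simp
next
  case (6 r s)
  then have "ll * x = ll * (ee ^ s * ff ^ r)"
    using ll_ee_power_ll by (metis mult.assoc)
  then show ?thesis using ordered_subsets(2)[OF ee_ff_in_ordered] by simp
qed

lemma ff_ll_ff_power_mult:
  assumes "ff ^ Suc r * ll * y \<in> kspan spanning_words" "ll * ff ^ Suc r * y \<in> kspan spanning_words"
  shows "ff * (ll * ff ^ r * y) \<in> kspan spanning_words"
proof -
  have "ff * ll * ff ^ r * y \<in> kspan spanning_words"
    unfolding kspan_def
    by (rule span_mult_right[OF E.q_ll_power]) (use assms in \<open>auto simp: kspan_def\<close>)
  then show ?thesis by (simp only: mult.assoc)
qed

lemma ee_ll_ee_power_mult:
  assumes "ee ^ Suc s * ll * y \<in> kspan spanning_words" "ll * ee ^ Suc s * y \<in> kspan spanning_words"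
  shows "ee * ll * (ee ^ s * y) \<in> kspan spanning_words"
proof -
  have "ee * ll * ee ^ s * y \<in> kspan spanning_words"
    unfolding kspan_def
    by (rule span_mult_right[OF F.q_ll_power]) (use assms in \<open>auto simp: kspan_def\<close>)
  then show ?thesis by (simp only: mult.assoc)
qed

text \<open>
  A factor \<open>f\<close> in front of \<open>l\<close> must be merged with powers of \<open>f\<close> behind it, by
  \<open>ff_ll_ff_power_mult\<close>; a factor in front of \<open>e\<^sup>s l f\<^sup>r\<close> first has to
  pass \<open>e\<^sup>s\<close>, which is \<open>q_mult_p_ll_q\<close>.
\<close>

lemma ff_mult_words:
  assumes "x \<in> spanning_words"
  shows "ff * x \<in> kspan spanning_words"
  using assms
proof (cases rule: spanning_words_cases)
  case (1 r s)
  then show ?thesis using in_words(1)[of "Suc r" s] by (simp add: mult.assoc)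
next
  case (2 r s)
  show ?thesis
    unfolding 2 by (rule ff_ll_ff_power_mult) (rule in_words)+
next
  case (3 r s)
  then show ?thesis using in_words(3)[of "Suc r" s] by (simp add: mult.assoc)
next
  case (4 r s)
  have "ff ^ Suc r * ll * (ee ^ s * ll) = ff ^ Suc r * ll * ee ^ s"
    using ll_ee_power_ll by (metis mult.assoc)
  moreover have "ll * ff ^ Suc r * (ee ^ s * ll) = ll * ff ^ Suc r * ee ^ s * ll"
    by (simp only: mult.assoc)
  ultimately have "ff * (ll * ff ^ r * (ee ^ s * ll)) \<in> kspan spanning_words"
    by (intro ff_ll_ff_power_mult) (simp_all only: in_words)
  then show ?thesis by (simp only: 4 mult.assoc)
next
  case (5 r s)
  then show ?thesis using in_words(5)[of "Suc r" s] by (simp add: mult.assoc)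
next
  case (6 r s)
  show ?thesis unfolding 6 by (rule E_ll_ordered_subset) (rule E.q_mult_p_ll_q)
qed

text \<open>
  Here \<open>e l\<close> meets \<open>f\<^sup>r e\<^sup>s\<close>, where the powers of \<open>e\<close> are out of reach. Rewriting \<open>f\<^sup>r e\<^sup>s\<close> in the
  opposite order \<open>e\<^sup>b f\<^sup>a\<close> first brings them next to \<open>l\<close>.
\<close>

lemma ee_mult_words:
  assumes "x \<in> spanning_words"
  shows "ee * x \<in> kspan spanning_words"
  using assms
proof (cases rule: spanning_words_cases)
  case (1 r s)
  show ?thesis unfolding 1
    by (intro ordered_subsets E.p_mult_ordered ff_ee_in_ordered)
next
  case (2 r s)
  have "ee * ll * (ff ^ r * ee ^ s) \<in> kspan spanning_words"
  proof (rule kspan_mult_left[OF ff_ee_in_opposite])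
    fix x assume "x \<in> F.ordered"
    then obtain b a where x: "x = ee ^ b * ff ^ a" by blast
    have "ll * ee ^ Suc b * ff ^ a \<in> kspan spanning_words"
      using ordered_subsets(2)[OF ee_ff_in_ordered] by (simp only: mult.assoc)
    then show "ee * ll * x \<in> kspan spanning_words"
      unfolding x by (intro ee_ll_ee_power_mult in_words)
  qed
  then show ?thesis by (simp only: 2 mult.assoc)
next
  case (3 r s)
  have "ee * (ff ^ r * ee ^ s) * ll \<in> kspan spanning_words"
    by (intro ordered_subsets E.p_mult_ordered ff_ee_in_ordered)
  then show ?thesis by (simp only: 3 mult.assoc)
next
  case (4 r s)
  have "ee * ll * (ff ^ r * ee ^ s) * ll \<in> kspan spanning_words"
  proof (rule kspan_mult[OF ff_ee_in_opposite _ kpow_ll])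
    fix x assume "x \<in> F.ordered"
    then obtain b a where x: "x = ee ^ b * ff ^ a" by blast
    have "ee ^ Suc b * ll * (ff ^ a * ll) \<in> kspan spanning_words"
    proof -
      have "ee ^ Suc b * ll * (ff ^ a * ll) = ee ^ Suc b * ff ^ a * ll"
        using ll_ff_power_ll by (metis mult.assoc)
      then show ?thesis using ordered_subsets(3)[OF ee_ff_in_ordered] by (simp only:)
    qed
    moreover have "ll * ee ^ Suc b * (ff ^ a * ll) \<in> kspan spanning_words"
      using ordered_subsets(4)[OF ee_ff_in_ordered] by (simp only: mult.assoc)
    ultimately have "ee * ll * (ee ^ b * (ff ^ a * ll)) \<in> kspan spanning_words"
      by (rule ee_ll_ee_power_mult)
    then show "ee * ll * x * ll \<in> kspan spanning_words"
      by (simp only: x mult.assoc)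
  qed
  then show ?thesis by (simp only: 4 mult.assoc)
next
  case (5 r s)
  show ?thesis unfolding 5 by (rule F_ll_ordered_subset) (rule F.q_mult_p_ll_q)
next
  case (6 r s)
  then show ?thesis using in_words(6)[of "Suc s" r] by (simp add: mult.assoc)
qed

lemma MU_gen_mult_words:
  assumes "y \<in> kspan spanning_words"
  shows "MU_gen g * y \<in> kspan spanning_words"
proof (cases g)
  case Ge
  then show ?thesis using kspan_mult_left[OF assms ee_mult_words] by simp
next
  case Gf
  then show ?thesis using kspan_mult_left[OF assms ff_mult_words] by simp
next
  case Gk
  then show ?thesis using kspan_kk(1)[OF homogeneous_spanning_words assms] by simp
next
  case Gkinv
  then show ?thesis using kspan_kk(2)[OF homogeneous_spanning_words assms] by simp
next
  case Gl
  then show ?thesis using kspan_mult_left[OF assms ll_mult_words] by simp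
qed

lemma abs_MU_in_kspan: "abs_MU x \<in> kspan spanning_words"
proof (induction x rule: free_alg_induct)
  case (single u c)
  have "abs_MU (Poly_Mapping.single (Word gs) 1) \<in> kspan spanning_words" for gs
  proof (induction gs)
    case Nil
    have "Poly_Mapping.single (Word []) 1 = (1 :: free_alg)"
      by (simp flip: zero_word_def)
    then show ?case using in_words(1)[of 0 0] by (simp add: abs_MU_simps)
  next
    case (Cons g gs)
    have "Poly_Mapping.single (Word (g # gs)) 1 = gen g * Poly_Mapping.single (Word gs) 1"
      by (simp add: gen_def mult_single plus_word_def)
    then show ?case using MU_gen_mult_words[OF Cons] by (simp add: abs_MU_simps)
  qed
  from this[of "letters u"] have "abs_MU (scal c * Poly_Mapping.single u 1) \<in> kspan spanning_words"
    by (simp add: abs_MU_simps(4) kspan_closed)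
  then show ?case by (simp add: scal_def mult_single)
next
  case (add x y)
  then show ?case by (simp add: abs_MU_simps kspan_closed)
qed

lemma spanning_words_kpow_in_span:
  assumes "x \<in> spanning_words"
  shows "x * kpow t \<in> MU.span (\<Union>i. MU_B i)"
proof -
  have base: "monomial i p \<in> MU.span (\<Union>i. MU_B i)" if "p \<in> index_set i" for i p
    using that by (intro MU.span_base) (auto simp: MU_B_def)
  from assms show ?thesis
  proof (cases rule: spanning_words_cases)
    case (1 r s)
    then show ?thesis using base[of "(r, s, t)" P0] by simp
  next
    case (2 r s)
    then show ?thesis using base[of "(r, s, t)" P1] by simp
  next
    case (3 r s)
    then show ?thesis
      using base[of "(r, s, t)" P2] base[of "(0, 0, t)" P1] by (cases "r = 0 \<and> s = 0") auto
  next
    case (4 r s)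
    consider "r = 0" | "s = 0" "r > 0" | "r > 0" "s > 0" by blast
    then show ?thesis
    proof cases
      case 1
      then show ?thesis using 4 base[of "(0, s, t)" P1] by (simp add: ll_ee_power_ll)
    next
      case 2
      then show ?thesis using 4 base[of "(r, 0, t)" P2] by (simp add: ll_ff_power_ll)
    next
      case 3
      then show ?thesis using 4 base[of "(r, s, t)" P3] by simp
    qed
  next
    case (5 r s)
    consider "r = 0" | "s = 0" "r > 0" | "r > 0" "s > 0" by blast
    then show ?thesis
    proof cases
      case 1
      then show ?thesis using 5 base[of "(0, s, t)" P1] by simp
    next
      case 2
      then show ?thesis using 5 base[of "(r, 0, t)" P2] by simp
    next
      case 3
      then show ?thesis using 5 base[of "(r, s, t)" P4] by simp
    qed
  next
    case (6 r s)
    consider "s = 0" | "r = 0" "s > 0" | "r > 0" "s > 0" by blast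
    then show ?thesis
    proof cases
      case 1
      then show ?thesis using 6 base[of "(r, 0, t)" P1] by simp
    next
      case 2
      then show ?thesis using 6 base[of "(0, s, t)" P2] by simp
    next
      case 3
      then show ?thesis using 6 base[of "(r, s, t)" P5] by simp
    qed
  qed
qed

lemma span_monomials: "MU.span (\<Union>i. MU_B i) = UNIV"
proof -
  have "x \<in> MU.span (\<Union>i. MU_B i)" for x
  proof -
    have "x \<in> kspan spanning_words"
      by (induction x) (rule abs_MU_in_kspan)
    moreover have "kspan spanning_words \<subseteq> MU.span (\<Union>i. MU_B i)"
      unfolding kspan_def by (rule span_subsetI) (auto intro: spanning_words_kpow_in_span)
    ultimately show ?thesis by blast
  qed
  then show ?thesis by blast
qed

section \<open>The basis theorem\<close>

theorem theorem4p7: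
  shows "(\<forall>i. inj_on (monomial i) (index_set i)) \<and>
         disjoint_family MU_B \<and>
         MU.independent (\<Union>i. MU_B i) \<and>
         MU.span (\<Union>i. MU_B i) = UNIV"
proof (intro conjI allI)
  show "inj_on (monomial i) (index_set i)" for i
  proof (rule inj_onI)
    fix x y assume "x \<in> index_set i" "y \<in> index_set i" "monomial i x = monomial i y"
    then show "x = y"
      using inj_onD[OF inj_on_monomial, of "(i, x)" "(i, y)"] by simp
  qed
  show "disjoint_family MU_B"
    unfolding disjoint_family_on_def
  proof (intro ballI impI)
    fix i j :: piece assume "i \<noteq> j"
    have "monomial i x \<noteq> monomial j y" if "x \<in> index_set i" "y \<in> index_set j" for x y
      using inj_onD[OF inj_on_monomial, of "(i, x)" "(j, y)"] that \<open>i \<noteq> j\<close> by auto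
    then show "MU_B i \<inter> MU_B j = {}"
      by (auto simp: MU_B_def)
  qed
qed (fact independent_monomials span_monomials)+

end
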